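(* Let $n\ge3$, let $\Omega=B_1$ be the open unit ball of $\mathbb{R}^n$, let $\gamma$ be a smooth radial function on $\overline{B_1}$, let $c=\nabla\gamma$, and let $f:[0,1)\to\mathbb{R}_+$ be $C^2$, positive, nondecreasing and convex in $[0,1)$ with $\lim_{t\to1^-}f(t)=\infty$. Then there exists $C>0$ such that for all $\lambda\in(0,\lambda^*]$ and all $r=|x|\in(0,1]$, $$|u_\lambda'(r)|\le\begin{cases}C\,r^{-1}&\text{if }n\ge10,\\[2pt] C\,r^{-\frac n2+1+\sqrt{n-1}}&\text{if }3\le n\le9,\end{cases}$$ where $|\cdot|$ is the Euclidean norm in $\mathbb{R}^n$, $u_\lambda$ is the minimal solution of $(P_\lambda)$ for $0<\lambda<\lambda^*$ (a radial function, written $u_\lambda(r)$), and $u_{\lambda^*}=u^*$ is the extremal solution.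
   Context: For $\lambda>0$, $(P_\lambda)$ is the problem $-\Delta u+c(x)\cdot\nabla u=\lambda f(u)$ in $\Omega$, $u>0$ in $\Omega$, $u=0$ on $\partial\Omega$. A solution $u$ is called regular if $u\in C^2(\overline{\Omega})$. A weak solution of $(P_\lambda)$ is a function $u$ with $0\le u\le1$ a.e. in $\Omega$, $f(u)\,d(x,\partial\Omega)\in L^1(\Omega)$ (with $f(1)=+\infty$), and $-\int_\Omega u\Delta\phi-\int_\Omega u\,\mathrm{div}(\phi c)=\lambda\int_\Omega f(u)\phi$ for all $\phi\in C^2(\overline{\Omega})\cap H_0^1(\Omega)$. There is $\lambda^*\in(0,\infty)$ (the supremum of the $\lambda>0$ for which $(P_\lambda)$ has a regular solution) such that for $0<\lambda<\lambda^*$ the problem $(P_\lambda)$ has a minimal solution $u_\lambda$ (i.e. $u_\lambda\le v$ for any solution $v$), which is regular, and $\lambda\mapsto u_\lambda$ is increasing. The extremal solution is $u^*:=\lim_{\lambda\to\lambda^*}u_\lambda$, the unique weak solution of $(P_{\lambda^*})$. In the radial setting considered here, $u_\lambda$ is radial by uniqueness of the minimal solution. *)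

theory Defs
  imports "HOL-Analysis.Analysis"
begin

text \<open>Derivatives are taken within \<open>S\<close>. On a convex set with nonempty interior they are unique,
  and on the closed ball this is the usual class of \<open>C\<^sup>k\<close> functions up to the boundary: all partial
  derivatives of order at most \<open>k\<close> exist inside and extend continuously to the closure. The
  components \<open>f' i\<close> are the partial derivatives of \<open>f\<close>.\<close>

primrec Ck_on :: "nat \<Rightarrow> 'a::euclidean_space set \<Rightarrow> ('a \<Rightarrow> real) \<Rightarrow> bool" where
  "Ck_on 0 S f \<longleftrightarrow> continuous_on S f"
| "Ck_on (Suc k) S f \<longleftrightarrow>
     (\<exists>f'. (\<forall>x\<in>S. (f has_derivative (\<lambda>h. \<Sum>i\<in>Basis. (h \<bullet> i) * f' i x)) (at x within S)) \<and>
           (\<forall>i\<in>Basis. Ck_on k S (f' i)))"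

definition smooth_on :: "'a::euclidean_space set \<Rightarrow> ('a \<Rightarrow> real) \<Rightarrow> bool" where
  "smooth_on S f \<longleftrightarrow> (\<forall>k. Ck_on k S f)"

definition radial_on :: "'a::real_normed_vector set \<Rightarrow> ('a \<Rightarrow> real) \<Rightarrow> bool" where
  "radial_on S g \<longleftrightarrow> (\<forall>x\<in>S. \<forall>y\<in>S. norm x = norm y \<longrightarrow> g x = g y)"

definition partial_deriv :: "'a::euclidean_space \<Rightarrow> ('a \<Rightarrow> real) \<Rightarrow> 'a \<Rightarrow> real" where
  "partial_deriv i g x = frechet_derivative g (at x) i"

definition grad :: "('a::euclidean_space \<Rightarrow> real) \<Rightarrow> 'a \<Rightarrow> 'a" where
  "grad g x = (\<Sum>i\<in>Basis. partial_deriv i g x *\<^sub>R i)"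

definition laplacian :: "('a::euclidean_space \<Rightarrow> real) \<Rightarrow> 'a \<Rightarrow> real" where
  "laplacian g x = (\<Sum>i\<in>Basis. partial_deriv i (partial_deriv i g) x)"

definition divergence :: "('a::euclidean_space \<Rightarrow> 'a) \<Rightarrow> 'a \<Rightarrow> real" where
  "divergence F x = (\<Sum>i\<in>Basis. partial_deriv i (\<lambda>y. F y \<bullet> i) x)"

text \<open>All problems below are posed on the open unit ball \<open>ball 0 1\<close>. Only the values of
  the nonlinearity \<open>f\<close> on \<open>[0,1)\<close> are meaningful, so a classical solution has \<open>u < 1\<close>.\<close>

definition regular_solution ::
  "('a::euclidean_space \<Rightarrow> 'a) \<Rightarrow> (real \<Rightarrow> real) \<Rightarrow> real \<Rightarrow> ('a \<Rightarrow> real) \<Rightarrow> bool" where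
  "regular_solution c f l u \<longleftrightarrow>
     Ck_on 2 (cball 0 1) u \<and>
     (\<forall>x\<in>ball 0 1. 0 < u x \<and> u x < 1 \<and> - laplacian u x + c x \<bullet> grad u x = l * f (u x)) \<and>
     (\<forall>x\<in>sphere 0 1. u x = 0)"

text \<open>The test functions \<open>C\<^sup>2(cball 0 1) \<inter> H\<^sub>0\<^sup>1(ball 0 1)\<close>, where \<open>H\<^sub>0\<^sup>1\<close> is the
  closure of the compactly supported smooth functions in the \<open>H\<^sup>1\<close> norm; the weak gradient of a
  \<open>C\<^sup>2\<close> function is its classical gradient.\<close>

definition test_function :: "('a::euclidean_space \<Rightarrow> real) \<Rightarrow> bool" where
  "test_function \<phi> \<longleftrightarrow>
     Ck_on 2 (cball 0 1) \<phi> \<and>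
     (\<exists>\<psi> :: nat \<Rightarrow> 'a \<Rightarrow> real.
        (\<forall>k. smooth_on UNIV (\<psi> k) \<and>
             (\<exists>K. compact K \<and> K \<subseteq> ball 0 1 \<and> (\<forall>x. x \<notin> K \<longrightarrow> \<psi> k x = 0))) \<and>
        (\<lambda>k. LINT x|lebesgue_on (ball 0 1).
                (\<phi> x - \<psi> k x)\<^sup>2 + (norm (grad \<phi> x - grad (\<psi> k) x))\<^sup>2) \<longlonglongrightarrow> 0)"

text \<open>The convention \<open>f(1) = \<infinity>\<close> makes the integrability condition force \<open>u < 1\<close> almost
  everywhere, so the value \<open>f 1\<close> plays no role in the last integral.\<close>

definition weak_solution ::
  "('a::euclidean_space \<Rightarrow> 'a) \<Rightarrow> (real \<Rightarrow> real) \<Rightarrow> real \<Rightarrow> ('a \<Rightarrow> real) \<Rightarrow> bool" where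
  "weak_solution c f l u \<longleftrightarrow>
     u \<in> borel_measurable (lebesgue_on (ball 0 1)) \<and>
     (AE x in lebesgue_on (ball 0 1). 0 \<le> u x \<and> u x \<le> 1) \<and>
     (\<integral>\<^sup>+x. (if u x = 1 then \<infinity> else ennreal (f (u x))) * ennreal (infdist x (sphere 0 1))
        \<partial>lebesgue_on (ball 0 1)) < \<infinity> \<and>
     (\<forall>\<phi>. test_function \<phi> \<longrightarrow>
        - (LINT x|lebesgue_on (ball 0 1). u x * laplacian \<phi> x)
        - (LINT x|lebesgue_on (ball 0 1). u x * divergence (\<lambda>y. \<phi> y *\<^sub>R c y) x)
        = l * (LINT x|lebesgue_on (ball 0 1). f (u x) * \<phi> x))"

text \<open>The supremum is that of a nonempty bounded set for the problems considered.\<close>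

definition lambda_star :: "('a::euclidean_space \<Rightarrow> 'a) \<Rightarrow> (real \<Rightarrow> real) \<Rightarrow> real" where
  "lambda_star c f = Sup {l. 0 < l \<and> (\<exists>u. regular_solution c f l u)}"

text \<open>A regular solution lying below every solution, classical or weak. It is determined uniquely
  on the closed ball.\<close>

definition minimal_solution ::
  "('a::euclidean_space \<Rightarrow> 'a) \<Rightarrow> (real \<Rightarrow> real) \<Rightarrow> real \<Rightarrow> ('a \<Rightarrow> real) \<Rightarrow> bool" where
  "minimal_solution c f l u \<longleftrightarrow>
     regular_solution c f l u \<and>
     (\<forall>v. regular_solution c f l v \<longrightarrow> (\<forall>x\<in>ball 0 1. u x \<le> v x)) \<and>
     (\<forall>v. weak_solution c f l v \<longrightarrow> (AE x in lebesgue_on (ball 0 1). u x \<le> v x))"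

definition extremal_solution ::
  "('a::euclidean_space \<Rightarrow> 'a) \<Rightarrow> (real \<Rightarrow> real) \<Rightarrow> ('a \<Rightarrow> real) \<Rightarrow> bool" where
  "extremal_solution c f u \<longleftrightarrow>
     (\<exists>U. (\<forall>l\<in>{0<..<lambda_star c f}. minimal_solution c f l (U l)) \<and>
          (\<forall>x\<in>cball 0 1. ((\<lambda>l. U l x) \<longlongrightarrow> u x) (at_left (lambda_star c f))))"

end

theory Submission
  imports Defs
begin

text \<open>
  Since \<open>c = \<nabla>\<gamma>\<close> with \<open>\<gamma>(x) = G(\<bar>x\<bar>)\<close>, a radial solution \<open>u(x) = y(\<bar>x\<bar>)\<close> satisfies
  \<open>-(p y')' = \<lambda> p f(y)\<close> with the weight \<open>p(r) = r\<^sup>n\<^sup>-\<^sup>1 e\<^sup>-\<^sup>G\<^sup>(\<^sup>r\<^sup>)\<close>, and everything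
  can be read off this ordinary differential equation. Write \<open>w = -y'\<close>.

  \<^bold>\<open>Radial symmetry.\<close> The radial equation with given right hand side is solved by two integrations,
  and by the maximum principle on the ball this radial potential stays below every supersolution. So
  the monotone iteration starting at \<open>0\<close> below a regular solution \<open>v\<close> consists of radial functions
  and converges to a radial solution below \<open>v\<close> (\<open>radial_solution_below\<close>). Applied
  to \<open>v = u\<^sub>\<lambda>\<close>, minimality makes this limit equal to \<open>u\<^sub>\<lambda>\<close>.

  \<^bold>\<open>The bound \<open>C/r\<close>.\<close> The flux \<open>p w\<close> is nondecreasing, and \<open>y\<close> changes by at most \<open>1\<close> on
  \<open>[r, 2r]\<close>; hence \<open>r w(r) \<le> C\<close>. As \<open>\<lambda> f(y)\<close> is nonincreasing in \<open>r\<close>, the same doubling argument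
  gives \<open>r\<^sup>2 \<lambda> f(y(r)) \<le> C\<close>, which controls \<open>w'\<close> and the boundary region \<open>[1/2, 1]\<close>
  (\<open>a_priori_bounds\<close>, \<open>second_deriv_bound\<close>). All constants depend on \<open>n\<close> and \<open>\<gamma>\<close> only. This
  settles \<open>n \<ge> 10\<close>.

  \<^bold>\<open>Semistability.\<close> Take a radial solution \<open>V\<close> for some \<open>\<lambda>' > \<lambda>\<close>, which lies above \<open>y\<close>. By convexity
  \<open>\<psi> = V - y\<close> satisfies \<open>-(p \<psi>')' \<ge> \<lambda> p f'(y) \<psi>\<close>: it is a positive supersolution of the linearised
  equation. On the other hand, differentiating the equation for \<open>y\<close> shows that \<open>w\<close> solves the linearised
  equation up to the potential \<open>(n-1)/r\<^sup>2 + G''\<close>. Picone's identity compares the two: with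
  \<open>Q = p w\<^sup>2 (\<psi>'/\<psi> - w'/w)\<close>, for every \<open>\<zeta>\<close>,
  \<open>(\<zeta>\<^sup>2 Q)' \<le> p w\<^sup>2 (\<zeta>'\<^sup>2 - ((n-1)/r\<^sup>2 + G'') \<zeta>\<^sup>2)\<close>.
  This is the pointwise form of testing the second variation with \<open>\<zeta> w\<close>.

  \<^bold>\<open>Decay.\<close> Near the origin \<open>\<zeta> = r\<close> gives \<open>Q(2s) \<le> - c p(s) w(s)\<^sup>2 / s\<close>
  (\<open>picone_quantitative\<close>). From \<open>2s\<close> outwards the borderline Hardy weight \<open>\<zeta> = r\<^sup>-\<^sup>\<beta> e\<^sup>r\<close> with
  \<open>\<beta> = \<surd>(n-1)\<close> keeps \<open>\<zeta>\<^sup>2 Q\<close> decreasing up to a fixed radius \<open>\<rho>\<close>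
  (\<open>weighted_picone_decreasing\<close>); the factor \<open>e\<^sup>r\<close> absorbs \<open>G''\<close>. At \<open>\<rho>\<close> the a priori bounds control \<open>-Q\<close>
  (\<open>picone_lower\<close>). Together \<open>w(s)\<^sup>2 \<le> C s\<^sup>2\<^sup>\<beta>\<^sup>+\<^sup>2\<^sup>-\<^sup>n\<close>, which is the claim
  (\<open>stable_estimate\<close>).

  \<^bold>\<open>The extremal solution.\<close> The bounds are uniform in \<open>\<lambda>\<close>, including one on the second derivatives away
  from the origin, so they pass to the limit \<open>\<lambda> \<rightarrow> \<lambda>\<^sup>*\<close> (\<open>derivative_of_limit\<close>).
\<close>

section \<open>Mean values and limits of derivatives\<close>

lemma mean_value_within:
  fixes F F' :: "real \<Rightarrow> real"
  assumes "a < b" "{a..b} \<subseteq> S"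
    and "\<And>x. x \<in> {a..b} \<Longrightarrow> (F has_real_derivative F' x) (at x within S)"
  obtains \<xi> where "a < \<xi>" "\<xi> < b" "F b - F a = (b - a) * F' \<xi>"
proof -
  have "(F has_derivative (*) (F' x)) (at x within {a..b})" if "a \<le> x" "x \<le> b" for x
    using DERIV_subset[OF assms(3) assms(2), of x] that by (simp add: has_field_derivative_def)
  from mvt_simple[OF assms(1) this] show ?thesis
    using that by (auto simp: mult.commute)
qed

lemma nondecreasing_within:
  fixes F F' :: "real \<Rightarrow> real"
  assumes "a \<le> b" "{a..b} \<subseteq> S"
    and "\<And>x. x \<in> {a..b} \<Longrightarrow> (F has_real_derivative F' x) (at x within S)"
    and "\<And>x. a < x \<Longrightarrow> x < b \<Longrightarrow> 0 \<le> F' x"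
  shows "F a \<le> F b"
proof (cases "a = b")
  case False
  then obtain \<xi> where "a < \<xi>" "\<xi> < b" "F b - F a = (b - a) * F' \<xi>"
    using mean_value_within[of a b S F F'] assms by auto
  then show ?thesis using assms(4)[of \<xi>] assms(1) by (smt (verit) mult_nonneg_nonneg)
qed simp

text \<open>The common Lipschitz bound on \<open>Y' k\<close> makes the first-order Taylor remainder at \<open>r\<close> quadratic
  uniformly in \<open>k\<close>. This passes to the pointwise limit once the derivatives at the single point \<open>r\<close>
  converge, and a subsequence of them does.\<close>

lemma derivative_of_limit:
  fixes T :: "real \<Rightarrow> real" and Y Y' :: "nat \<Rightarrow> real \<Rightarrow> real"
  assumes r: "r \<in> {a..b}"
    and d: "\<And>k s. s \<in> {a..b} \<Longrightarrow> (Y k has_real_derivative Y' k s) (at s within {a..b})"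
    and lip: "\<And>k s. s \<in> {a..b} \<Longrightarrow> \<bar>Y' k s - Y' k r\<bar> \<le> B * \<bar>s - r\<bar>"
    and A: "\<And>k. \<bar>Y' k r\<bar> \<le> A"
    and lim: "\<And>s. s \<in> {a..b} \<Longrightarrow> (\<lambda>k. Y k s) \<longlonglongrightarrow> T s"
  shows "\<exists>D. \<bar>D\<bar> \<le> A \<and> (T has_real_derivative D) (at r within {a..b})"
proof -
  have "bounded (range (\<lambda>k. Y' k r))" using A by (auto simp: bounded_real)
  then obtain D g where g: "strict_mono (g :: nat \<Rightarrow> nat)" "((\<lambda>k. Y' k r) \<circ> g) \<longlonglongrightarrow> D"
    using bounded_imp_convergent_subsequence by blast
  have D: "(\<lambda>k. Y' (g k) r) \<longlonglongrightarrow> D" using g(2) by (simp add: o_def)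
  have DA: "\<bar>D\<bar> \<le> A"
    by (rule LIMSEQ_le_const2[OF tendsto_rabs[OF D]]) (use A in auto)
  have taylor: "\<bar>Y k s - Y k r - Y' k r * (s - r)\<bar> \<le> B * \<bar>s - r\<bar> * \<bar>s - r\<bar>" if s: "s \<in> {a..b}" for k s
  proof -
    have "\<exists>\<xi>\<in>{a..b}. \<bar>\<xi> - r\<bar> \<le> \<bar>s - r\<bar> \<and> Y k s - Y k r = Y' k \<xi> * (s - r)"
    proof (cases s r rule: linorder_cases)
      case less
      then obtain \<xi> where "s < \<xi>" "\<xi> < r" "Y k r - Y k s = (r - s) * Y' k \<xi>"
        using mean_value_within[of s r "{a..b}" "Y k" "Y' k"] d s r by auto
      then show ?thesis using s r by (intro bexI[of _ \<xi>]) (auto simp: algebra_simps)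
    next
      case greater
      then obtain \<xi> where "r < \<xi>" "\<xi> < s" "Y k s - Y k r = (s - r) * Y' k \<xi>"
        using mean_value_within[of r s "{a..b}" "Y k" "Y' k"] d s r by auto
      then show ?thesis using s r by (intro bexI[of _ \<xi>]) (auto simp: algebra_simps)
    qed (use s in auto)
    then obtain \<xi> where \<xi>: "\<xi> \<in> {a..b}" "\<bar>\<xi> - r\<bar> \<le> \<bar>s - r\<bar>" "Y k s - Y k r = Y' k \<xi> * (s - r)" by blast
    have "\<bar>Y' k \<xi> - Y' k r\<bar> \<le> B * \<bar>s - r\<bar>"
    proof (cases "\<xi> = r")
      case True
      then show ?thesis using lip[OF s, of k] by (metis abs_ge_zero abs_zero diff_self order_trans)
    next
      case False
      then have "0 < \<bar>\<xi> - r\<bar>" by simp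
      moreover have "0 \<le> B * \<bar>\<xi> - r\<bar>" using lip[OF \<xi>(1), of k] by linarith
      ultimately have "0 \<le> B" by (simp add: zero_le_mult_iff)
      then have "B * \<bar>\<xi> - r\<bar> \<le> B * \<bar>s - r\<bar>" using \<xi>(2) by (intro mult_left_mono)
      then show ?thesis using lip[OF \<xi>(1), of k] by linarith
    qed
    then have "\<bar>Y' k \<xi> - Y' k r\<bar> * \<bar>s - r\<bar> \<le> B * \<bar>s - r\<bar> * \<bar>s - r\<bar>" by (intro mult_right_mono) auto
    moreover have "Y k s - Y k r - Y' k r * (s - r) = (Y' k \<xi> - Y' k r) * (s - r)"
      using \<xi>(3) by (simp add: algebra_simps)
    ultimately show ?thesis by (simp add: abs_mult)
  qed
  have T: "\<bar>T s - T r - D * (s - r)\<bar> \<le> B * \<bar>s - r\<bar> * \<bar>s - r\<bar>" if s: "s \<in> {a..b}" for s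
  proof (rule LIMSEQ_le_const2)
    show "(\<lambda>k. \<bar>Y (g k) s - Y (g k) r - Y' (g k) r * (s - r)\<bar>) \<longlonglongrightarrow> \<bar>T s - T r - D * (s - r)\<bar>"
      using LIMSEQ_subseq_LIMSEQ[OF lim[OF s] g(1)] LIMSEQ_subseq_LIMSEQ[OF lim[OF r] g(1)]
      by (intro tendsto_intros D) (simp_all add: o_def)
  qed (use taylor[OF s] in auto)
  have "((\<lambda>s. (T s - T r) / (s - r)) \<longlongrightarrow> D) (at r within {a..b})"
    unfolding Lim_null[of _ D]
  proof (rule Lim_null_comparison)
    have bd: "norm ((T s - T r) / (s - r) - D) \<le> \<bar>B\<bar> * \<bar>s - r\<bar>" if "s \<in> {a..b}" "s \<noteq> r" for s
    proof -
      have "(T s - T r) / (s - r) - D = (T s - T r - D * (s - r)) / (s - r)"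
        using that by (simp add: field_simps)
      then have "\<bar>(T s - T r) / (s - r) - D\<bar> = \<bar>T s - T r - D * (s - r)\<bar> / \<bar>s - r\<bar>" by simp
      also have "\<dots> \<le> B * \<bar>s - r\<bar>" using T[OF that(1)] that by (simp add: divide_le_eq)
      also have "\<dots> \<le> \<bar>B\<bar> * \<bar>s - r\<bar>" by (intro mult_right_mono) auto
      finally show ?thesis by simp
    qed
    then show "\<forall>\<^sub>F s in at r within {a..b}. norm ((T s - T r) / (s - r) - D) \<le> \<bar>B\<bar> * \<bar>s - r\<bar>"
      unfolding eventually_at_filter by (intro always_eventually allI impI)
    have "((\<lambda>s. \<bar>B\<bar> * \<bar>s - r\<bar>) \<longlongrightarrow> \<bar>B\<bar> * \<bar>r - r\<bar>) (at r within {a..b})"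
      by (intro tendsto_intros)
    then show "((\<lambda>s. \<bar>B\<bar> * \<bar>s - r\<bar>) \<longlongrightarrow> 0) (at r within {a..b})" by simp
  qed
  then show ?thesis using DA by (auto simp: has_field_derivative_iff)
qed

section \<open>Twice differentiable functions on the unit ball\<close>

lemma frechet_derivative_worksI: "f differentiable F \<Longrightarrow> (f has_derivative frechet_derivative f F) F"
  by (simp add: frechet_derivative_works)

lemma sum_Basis_component:
  fixes i :: "'a::euclidean_space" and c :: "'a \<Rightarrow> real"
  assumes "i \<in> Basis"
  shows "(\<Sum>j\<in>Basis. (i \<bullet> j) * c j) = c i"
proof -
  have "(\<Sum>j\<in>Basis. (i \<bullet> j) * c j) = (\<Sum>j\<in>Basis. if j = i then c j else 0)"
    using assms by (intro sum.cong) (auto simp: inner_Basis)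
  then show ?thesis using assms by simp
qed

lemma partial_deriv_eqI:
  fixes f :: "'a::euclidean_space \<Rightarrow> real"
  assumes "(f has_derivative (\<lambda>h. \<Sum>j\<in>Basis. (h \<bullet> j) * f' j)) (at x)" and "i \<in> Basis"
  shows "partial_deriv i f x = f' i"
  using frechet_derivative_at[OF assms(1), symmetric] sum_Basis_component[OF assms(2)]
  by (simp add: partial_deriv_def)

lemma Ck_on_2D:
  assumes "Ck_on 2 S f"
  shows "\<exists>f' f''. (\<forall>x\<in>S. (f has_derivative (\<lambda>h. \<Sum>i\<in>Basis. (h \<bullet> i) * f' i x)) (at x within S)) \<and>
    (\<forall>i\<in>Basis. \<forall>x\<in>S.
       (f' i has_derivative (\<lambda>h. \<Sum>j\<in>Basis. (h \<bullet> j) * f'' i j x)) (at x within S)) \<and>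
    (\<forall>i\<in>Basis. \<forall>j\<in>Basis. continuous_on S (f'' i j))"
proof -
  have "Ck_on (Suc (Suc 0)) S f" using assms by (simp only: numeral_2_eq_2)
  then obtain f' where f': "\<forall>x\<in>S.
      (f has_derivative (\<lambda>h. \<Sum>i\<in>Basis. (h \<bullet> i) * f' i x)) (at x within S)"
    and 1: "\<And>i. i \<in> Basis \<Longrightarrow> Ck_on (Suc 0) S (f' i)"
    unfolding Ck_on.simps(2)[of "Suc 0"] by blast
  have "\<forall>i\<in>Basis. \<exists>d. (\<forall>x\<in>S. (f' i has_derivative (\<lambda>h. \<Sum>j\<in>Basis. (h \<bullet> j) * d j x)) (at x within S)) \<and>
      (\<forall>j\<in>Basis. continuous_on S (d j))"
    using 1 by simp
  from bchoice[OF this] obtain f'' where "\<forall>i\<in>Basis. (\<forall>x\<in>S. (f' i has_derivative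
      (\<lambda>h. \<Sum>j\<in>Basis. (h \<bullet> j) * f'' i j x)) (at x within S)) \<and> (\<forall>j\<in>Basis. continuous_on S (f'' i j))"
    by blast
  with f' show ?thesis by (intro exI[of _ f'] exI[of _ f'']) blast
qed

lemma Ck_on_2_differentiable:
  fixes f :: "'a::euclidean_space \<Rightarrow> real"
  assumes "Ck_on 2 (cball 0 1) f" and x: "x \<in> ball 0 1"
  shows "f differentiable (at x)"
    and "i \<in> Basis \<Longrightarrow> partial_deriv i f differentiable (at x)"
proof -
  obtain f' f'' where d1: "\<And>x. x \<in> cball 0 1 \<Longrightarrow>
      (f has_derivative (\<lambda>h. \<Sum>i\<in>Basis. (h \<bullet> i) * f' i x)) (at x within cball 0 1)"
    and d2: "\<And>i x. i \<in> Basis \<Longrightarrow> x \<in> cball 0 1 \<Longrightarrow>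
       (f' i has_derivative (\<lambda>h. \<Sum>j\<in>Basis. (h \<bullet> j) * f'' i j x)) (at x within cball 0 1)"
    and "\<And>i j. i \<in> Basis \<Longrightarrow> j \<in> Basis \<Longrightarrow> continuous_on (cball 0 1) (f'' i j)"
    using Ck_on_2D[OF assms(1)] by blast
  have at: "at y within cball 0 1 = at y" if "y \<in> ball 0 1" for y :: 'a
    using that by (intro at_within_interior) simp
  have d1': "(f has_derivative (\<lambda>h. \<Sum>i\<in>Basis. (h \<bullet> i) * f' i y)) (at y)" if "y \<in> ball 0 1" for y
    using d1[of y] at[OF that] that by auto
  show "f differentiable (at x)" using d1'[OF x] differentiableI by blast
  assume i: "i \<in> Basis"
  have "(f' i has_derivative (\<lambda>h. \<Sum>j\<in>Basis. (h \<bullet> j) * f'' i j x)) (at x)"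
    using d2[OF i, of x] at[OF x] x by auto
  then have "(partial_deriv i f has_derivative (\<lambda>h. \<Sum>j\<in>Basis. (h \<bullet> j) * f'' i j x)) (at x)"
    by (rule has_derivative_transform_within_open[OF _ open_ball x])
       (simp add: partial_deriv_eqI[OF d1' i])
  then show "partial_deriv i f differentiable (at x)" using differentiableI by blast
qed

lemma Ck_on_2_continuous: "Ck_on 2 S f \<Longrightarrow> continuous_on S f"
  using Ck_on_2D[of S f] has_derivative_continuous[of f]
  unfolding continuous_on_eq_continuous_within by blast

lemma partial_deriv_diff:
  assumes "f differentiable (at x)" "g differentiable (at x)"
  shows "partial_deriv i (\<lambda>x. f x - g x) x = partial_deriv i f x - partial_deriv i g x"
  using frechet_derivative_at[OF has_derivative_diff[OF assms[THEN frechet_derivative_worksI]]]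
  unfolding partial_deriv_def by metis

lemma grad_diff:
  assumes "f differentiable (at x)" "g differentiable (at x)"
  shows "grad (\<lambda>x. f x - g x) x = grad f x - grad g x"
  using partial_deriv_diff[OF assms] by (simp add: grad_def scaleR_left_diff_distrib sum_subtractf)

lemma partial_deriv_cong:
  assumes "open S" "x \<in> S" "\<And>y. y \<in> S \<Longrightarrow> f y = g y"
  shows "partial_deriv i f x = partial_deriv i g x"
proof -
  have "(f has_derivative D) (at x) \<longleftrightarrow> (g has_derivative D) (at x)" for D
    using assms has_derivative_transform_within_open[OF _ assms(1,2)] by metis
  then show ?thesis by (simp add: partial_deriv_def frechet_derivative_def)
qed

lemma laplacian_diff:
  fixes f g :: "'a::euclidean_space \<Rightarrow> real"
  assumes "Ck_on 2 (cball 0 1) f" "Ck_on 2 (cball 0 1) g" "x \<in> ball 0 1"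
  shows "laplacian (\<lambda>x. f x - g x) x = laplacian f x - laplacian g x"
proof -
  have "partial_deriv i (partial_deriv i (\<lambda>x. f x - g x)) x =
      partial_deriv i (partial_deriv i f) x - partial_deriv i (partial_deriv i g) x"
    if i: "i \<in> Basis" for i
  proof -
    have "partial_deriv i (partial_deriv i (\<lambda>x. f x - g x)) x =
        partial_deriv i (\<lambda>y. partial_deriv i f y - partial_deriv i g y) x"
      using assms by (intro partial_deriv_cong[OF open_ball assms(3)] partial_deriv_diff)
        (auto intro: Ck_on_2_differentiable)
    also have "\<dots> = partial_deriv i (partial_deriv i f) x - partial_deriv i (partial_deriv i g) x"
      using assms i by (intro partial_deriv_diff) (auto intro: Ck_on_2_differentiable)
    finally show ?thesis .
  qed
  then show ?thesis by (simp add: laplacian_def sum_subtractf)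
qed

text \<open>If the second derivative along \<open>i\<close> were negative, the first derivative would turn negative to
  the right of the minimum and the function would drop below its minimum.\<close>

lemma interior_minimum_derivatives:
  fixes z :: "'a::euclidean_space \<Rightarrow> real"
  assumes S: "open S" "x \<in> S" and min: "\<And>y. y \<in> S \<Longrightarrow> z x \<le> z y"
    and d1: "\<And>y. y \<in> S \<Longrightarrow> z differentiable (at y)"
    and d2: "partial_deriv i z differentiable (at x)"
  shows "partial_deriv i z x = 0" and "partial_deriv i (partial_deriv i z) x \<ge> 0"
proof -
  define a where "a t = z (x + t *\<^sub>R i)" for t
  have line: "((\<lambda>t. g (x + t *\<^sub>R i)) has_real_derivative partial_deriv i g (x + t *\<^sub>R i)) (at t)"
    if "g differentiable (at (x + t *\<^sub>R i))" for g :: "'a \<Rightarrow> real" and t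
  proof -
    note g = frechet_derivative_worksI[OF that]
    have *: "((\<lambda>t. x + t *\<^sub>R i) has_derivative (\<lambda>s. s *\<^sub>R i)) (at t)"
      by (auto intro!: derivative_eq_intros)
    have "((\<lambda>t. g (x + t *\<^sub>R i)) has_derivative
        (\<lambda>s. frechet_derivative g (at (x + t *\<^sub>R i)) (s *\<^sub>R i))) (at t)"
      using has_derivative_compose[OF * g] .
    moreover have "frechet_derivative g (at (x + t *\<^sub>R i)) (s *\<^sub>R i)
        = s * partial_deriv i g (x + t *\<^sub>R i)" for s
      using has_derivative_linear[OF g] by (simp add: linear_cmul partial_deriv_def)
    ultimately show ?thesis by (simp add: has_field_derivative_def mult_commute_abs)
  qed
  have "open ((\<lambda>t. x + t *\<^sub>R i) -` S)"
    by (intro open_vimage S continuous_intros)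
  moreover have "0 \<in> (\<lambda>t. x + t *\<^sub>R i) -` S" using S by simp
  ultimately obtain e where e: "e > 0" "ball 0 e \<subseteq> (\<lambda>t. x + t *\<^sub>R i) -` S"
    using openE by blast
  have inS: "x + t *\<^sub>R i \<in> S" if "\<bar>t\<bar> < e" for t
    using e(2) that by (force simp: dist_norm)
  have a': "(a has_real_derivative partial_deriv i z (x + t *\<^sub>R i)) (at t)" if "\<bar>t\<bar> < e" for t
    unfolding a_def by (intro line d1 inS that)
  have amin: "a 0 \<le> a t" if "\<bar>t\<bar> < e" for t
    unfolding a_def using min[OF inS[OF that]] by simp
  show 0: "partial_deriv i z x = 0"
    using DERIV_local_min[OF a'[of 0] \<open>e > 0\<close>] amin \<open>e > 0\<close> by auto
  show "partial_deriv i (partial_deriv i z) x \<ge> 0"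
  proof (rule ccontr)
    assume "\<not> ?thesis"
    then have neg: "partial_deriv i (partial_deriv i z) x < 0" by simp
    have "((\<lambda>t. partial_deriv i z (x + t *\<^sub>R i)) has_real_derivative
        partial_deriv i (partial_deriv i z) x) (at 0)"
      using line[of "partial_deriv i z" 0] d2 by simp
    from DERIV_neg_dec_right[OF this neg] obtain d where d: "d > 0"
      "\<And>h. 0 < h \<Longrightarrow> h < d \<Longrightarrow> partial_deriv i z (x + h *\<^sub>R i) < 0"
      using 0 by auto
    define h where "h = min d e / 2"
    have h: "0 < h" "h < d" "h < e" using d e by (auto simp: h_def min_def)
    obtain s where s: "0 < s" "s < h" "a h - a 0 = (h - 0) * partial_deriv i z (x + s *\<^sub>R i)"
      using MVT2[OF h(1), of a "\<lambda>t. partial_deriv i z (x + t *\<^sub>R i)"] a' h by force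
    then have "a h < a 0" using mult_pos_neg[OF h(1) d(2)[of s]] h by simp
    then show False using amin[of h] h by simp
  qed
qed

text \<open>At an interior minimum of \<open>v - w\<close> the gradients agree and the Laplacians are ordered the wrong
  way for the strict differential inequality. So the minimum lies on the sphere. The drift
  term vanishes at the minimum together with the gradient.\<close>

lemma strict_comparison_principle:
  fixes v w :: "'a::euclidean_space \<Rightarrow> real"
  assumes v: "Ck_on 2 (cball 0 1) v" and w: "Ck_on 2 (cball 0 1) w"
    and lt: "\<And>x. x \<in> ball 0 1 \<Longrightarrow>
      - laplacian w x + c x \<bullet> grad w x < - laplacian v x + c x \<bullet> grad v x"
    and bd: "\<And>x. x \<in> sphere 0 1 \<Longrightarrow> w x \<le> v x"
    and x: "x \<in> cball 0 1"
  shows "w x \<le> v x"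
proof -
  define z where "z x = v x - w x" for x
  have "continuous_on (cball 0 1) z"
    unfolding z_def by (intro continuous_intros Ck_on_2_continuous v w)
  then obtain x0 where x0: "x0 \<in> cball 0 1" "\<And>y. y \<in> cball 0 1 \<Longrightarrow> z x0 \<le> z y"
    using continuous_attains_inf[of "cball 0 1" z] by auto
  have "x0 \<notin> ball 0 1"
  proof
    assume b: "x0 \<in> ball 0 1"
    have dz: "z differentiable (at y)" if "y \<in> ball 0 1" for y
      unfolding z_def using Ck_on_2_differentiable(1)[OF v that] Ck_on_2_differentiable(1)[OF w that]
      by simp
    have "partial_deriv i z differentiable (at x0)" if i: "i \<in> Basis" for i
    proof -
      have "(\<lambda>y. partial_deriv i v y - partial_deriv i w y) differentiable (at x0)"
        using Ck_on_2_differentiable(2)[OF v b i] Ck_on_2_differentiable(2)[OF w b i] by simp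
      then obtain D where "((\<lambda>y. partial_deriv i v y - partial_deriv i w y) has_derivative D) (at x0)"
        by (auto simp: differentiable_def)
      then have "(partial_deriv i z has_derivative D) (at x0)"
        by (rule has_derivative_transform_within_open[OF _ open_ball b])
           (auto simp: z_def[abs_def] intro!: partial_deriv_diff[symmetric] Ck_on_2_differentiable v w)
      then show ?thesis by (auto simp: differentiable_def)
    qed
    then have m: "partial_deriv i z x0 = 0" "partial_deriv i (partial_deriv i z) x0 \<ge> 0"
      if "i \<in> Basis" for i
      using that interior_minimum_derivatives[OF open_ball b, of z i] x0(2) dz by auto
    have "laplacian z x0 \<ge> 0" unfolding laplacian_def by (intro sum_nonneg m)
    moreover have "grad z x0 = 0" unfolding grad_def by (simp add: m)
    moreover have "laplacian z x0 = laplacian v x0 - laplacian w x0"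
      unfolding z_def[abs_def] by (rule laplacian_diff[OF v w b])
    moreover have "grad z x0 = grad v x0 - grad w x0"
      unfolding z_def[abs_def]
      by (intro grad_diff Ck_on_2_differentiable[OF v b] Ck_on_2_differentiable[OF w b])
    ultimately show False using lt[OF b] by simp
  qed
  then have "z x0 \<ge> 0" using x0(1) bd[of x0] by (auto simp: z_def)
  then show ?thesis using x0(2)[OF x] by (simp add: z_def)
qed

lemma grad_inner:
  assumes "g differentiable (at x)"
  shows "grad g x \<bullet> y = frechet_derivative g (at x) y"
proof -
  interpret linear "frechet_derivative g (at x)"
    using has_derivative_linear[OF frechet_derivative_worksI[OF assms]] .
  have "frechet_derivative g (at x) y = frechet_derivative g (at x) (\<Sum>i\<in>Basis. (y \<bullet> i) *\<^sub>R i)"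
    by (simp add: euclidean_representation)
  also have "\<dots> = (\<Sum>i\<in>Basis. (y \<bullet> i) * partial_deriv i g x)"
    by (simp add: sum scale partial_deriv_def)
  also have "\<dots> = grad g x \<bullet> y"
    by (simp add: grad_def inner_sum_left inner_commute[of y] mult.commute)
  finally show ?thesis by simp
qed

section \<open>The weighted radial operator\<close>

text \<open>The radial part of \<open>\<gamma>\<close> is \<open>G\<close>, with derivatives \<open>G1\<close> and \<open>G2\<close>. The common bound \<open>K\<close> is a
  parameter so that all later constants are explicit in \<open>n\<close> and \<open>K\<close>.\<close>

locale radial_weight =
  fixes n :: nat and G G1 G2 :: "real \<Rightarrow> real" and K :: real
  assumes n3: "n \<ge> 3"
    and G_deriv: "\<And>r. r \<in> {0..1} \<Longrightarrow> (G has_real_derivative G1 r) (at r within {0..1})"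
    and G1_deriv: "\<And>r. r \<in> {0..1} \<Longrightarrow> (G1 has_real_derivative G2 r) (at r within {0..1})"
    and G_bound: "\<And>r. r \<in> {0..1} \<Longrightarrow> \<bar>G r\<bar> \<le> K"
    and G1_bound: "\<And>r. r \<in> {0..1} \<Longrightarrow> \<bar>G1 r\<bar> \<le> K"
    and G2_bound: "\<And>r. r \<in> {0..1} \<Longrightarrow> \<bar>G2 r\<bar> \<le> K"
begin

definition weight :: "real \<Rightarrow> real" where
  "weight r = r ^ (n - 1) * exp (- G r)"

definition flux :: "(real \<Rightarrow> real) \<Rightarrow> real \<Rightarrow> real" where
  "flux h r = integral {0..r} (\<lambda>t. weight t * h t)"

text \<open>The solution of \<open>-(p W')' = p h\<close> with \<open>W 1 = 0\<close> is written as \<open>W' = - r m\<close>. Dividing by \<open>r\<close>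
  removes the singularity at the origin: \<open>m\<close> is continuous up to \<open>0\<close>, and the gradient of
  \<open>W(\<bar>x\<bar>)\<close> is \<open>- m(\<bar>x\<bar>) x\<close>. The value at \<open>0\<close> is the limit.\<close>

definition slope :: "(real \<Rightarrow> real) \<Rightarrow> real \<Rightarrow> real" where
  "slope h r = (if r = 0 then h 0 / n else flux h r / (weight r * r))"

definition potential :: "(real \<Rightarrow> real) \<Rightarrow> real \<Rightarrow> real" where
  "potential h r = integral {r..1} (\<lambda>s. s * slope h s)"

text \<open>The equation itself, for a pair \<open>W\<close>, \<open>m = -W'/r\<close>. It determines \<open>W\<close>, but as a predicate it
  applies to functions that are not given by the integrals above.\<close>

definition profile :: "(real \<Rightarrow> real) \<Rightarrow> (real \<Rightarrow> real) \<Rightarrow> (real \<Rightarrow> real) \<Rightarrow> bool" where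
  "profile h W m \<longleftrightarrow>
     continuous_on {0..1} m \<and> real n * m 0 = h 0 \<and> W 1 = 0 \<and>
     (\<forall>r\<in>{0..1}. (W has_real_derivative - (r * m r)) (at r within {0..1})) \<and>
     (\<forall>r\<in>{0..1}. ((\<lambda>r. weight r * (r * m r)) has_real_derivative weight r * h r) (at r within {0..1}))"

lemma K_nonneg: "K \<ge> 0"
  using G_bound[of 0] by simp

lemma continuous_G: "continuous_on {0..1} G" and continuous_G1: "continuous_on {0..1} G1"
  using G_deriv G1_deriv DERIV_continuous_on by blast+

lemma weight_pos: "0 < r \<Longrightarrow> 0 < weight r" and weight_nonneg: "0 \<le> r \<Longrightarrow> 0 \<le> weight r"
  by (simp_all add: weight_def)

lemma weight_lower: "r \<in> {0..1} \<Longrightarrow> exp (- K) * r ^ (n - 1) \<le> weight r"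
  and weight_upper: "r \<in> {0..1} \<Longrightarrow> weight r \<le> exp K * r ^ (n - 1)"
  using G_bound[of r] by (auto simp: weight_def mult.commute intro!: mult_right_mono)

lemma continuous_weight: "continuous_on {0..1} weight"
  unfolding weight_def by (intro continuous_intros continuous_G)

lemma weight_times_id: "weight r * r = r ^ n * exp (- G r)"
  using n3 power_minus_mult[of n r] by (simp add: weight_def algebra_simps)

lemma weight_deriv:
  assumes "r \<in> {0<..1}"
  shows "(weight has_real_derivative weight r * ((real n - 1) / r - G1 r)) (at r within {0..1})"
proof -
  have "((\<lambda>r. r ^ (n - 1) * exp (- G r)) has_real_derivative
     (real (n - 1) * r ^ (n - 1 - 1)) * exp (- G r) + (exp (- G r) * - G1 r) * r ^ (n - 1)) (at r within {0..1})"
    using assms by (auto intro!: derivative_eq_intros G_deriv)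
  moreover have "r ^ (n - 1 - 1) = r ^ (n - 1) / r"
    using assms n3 power_minus_mult[of "n - 1" r] by (simp add: field_simps)
  moreover have "real (n - 1) = real n - 1" using n3 by simp
  ultimately show ?thesis
    using assms unfolding weight_def[abs_def] by (simp add: field_simps)
qed

lemma profileD:
  assumes "profile h W m"
  shows "continuous_on {0..1} m" "real n * m 0 = h 0" "W 1 = 0"
    "r \<in> {0..1} \<Longrightarrow> (W has_real_derivative - (r * m r)) (at r within {0..1})"
    "r \<in> {0..1} \<Longrightarrow>
      ((\<lambda>r. weight r * (r * m r)) has_real_derivative weight r * h r) (at r within {0..1})"
  using assms by (auto simp: profile_def)

text \<open>Away from the origin \<open>m\<close> is the flux divided by \<open>p r\<close>. The numerator below, \<open>r m'(r)\<close>,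
  extends continuously to \<open>0\<close> and vanishes there, which is what makes the Hessian continuous.\<close>

lemma profile_slope_deriv:
  assumes P: "profile h W m" and r: "r \<in> {0<..1}"
  shows "(m has_real_derivative (h r - (n - r * G1 r) * m r) / r) (at r within {0..1})"
proof -
  have r': "r \<in> {0..1}" "r > 0" using r by auto
  have d: "((\<lambda>r. weight r * (r * m r) / (weight r * r)) has_real_derivative
     ((weight r * h r) * (weight r * r) - (weight r * (r * m r)) *
        (weight r * ((real n - 1) / r - G1 r) * r + 1 * weight r)) / ((weight r * r) * (weight r * r)))
      (at r within {0..1})"
    using weight_pos[OF r'(2)] r' by (intro DERIV_divide DERIV_mult profileD[OF P] weight_deriv[OF r] DERIV_ident) auto
  have "((weight r * h r) * (weight r * r) - (weight r * (r * m r)) *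
        (weight r * ((real n - 1) / r - G1 r) * r + 1 * weight r)) / ((weight r * r) * (weight r * r))
      = (h r - (n - r * G1 r) * m r) / r"
    using weight_pos[OF r'(2)] r' by (simp add: field_simps)
  note d = d[unfolded this]
  show ?thesis
  proof (rule has_field_derivative_transform_within[OF d])
    show "r > 0" "r \<in> {0..1}" using r by auto
    fix x assume "x \<in> {0..1}" "dist x r < r"
    then have "x > 0" by (auto simp: dist_real_def)
    then show "weight x * (x * m x) / (weight x * x) = m x" using weight_pos[of x] by simp
  qed
qed

lemma flux_deriv:
  assumes "continuous_on {0..1} h" "r \<in> {0..1}"
  shows "(flux h has_real_derivative weight r * h r) (at r within {0..1})"
  unfolding flux_def[abs_def]
  by (rule integral_has_real_derivative) (use assms in \<open>auto intro!: continuous_intros continuous_weight\<close>)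

text \<open>Only the origin needs an argument: l'Hopital's rule for the flux against \<open>r ^ n\<close>.\<close>

lemma continuous_slope:
  assumes h: "continuous_on {0..1} h"
  shows "continuous_on {0..1} (slope h)"
proof -
  have "continuous (at r within {0..1}) (slope h)" if r: "r \<in> {0..1}" for r
  proof (cases "r = 0")
    case False
    have "((\<lambda>r. flux h r / (weight r * r)) \<longlongrightarrow> flux h r / (weight r * r)) (at r within {0..1})"
      using False r weight_pos[of r] DERIV_continuous[OF flux_deriv[OF h r]] continuous_weight
      by (intro tendsto_intros) (auto simp: continuous_on_def continuous_within)
    moreover have "\<forall>\<^sub>F s in at r within {0..1}. flux h s / (weight s * s) = slope h s"
    proof -
      have "\<forall>\<^sub>F s in at r within {0..1}. s \<noteq> (0::real)"
        using False by (intro eventually_neq_at_within)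
      then show ?thesis by eventually_elim (simp add: slope_def)
    qed
    ultimately have "(slope h \<longlongrightarrow> flux h r / (weight r * r)) (at r within {0..1})"
      by (rule Lim_transform_eventually)
    then show ?thesis using False by (simp add: continuous_within slope_def)
  next
    case True
    have at0: "at 0 within {0..1} = at_right (0::real)"
      by (simp add: at_within_Icc_at_right)
    have "((\<lambda>r. flux h r / r ^ n) \<longlongrightarrow> exp (- G 0) * h 0 / n) (at_right 0)"
    proof (rule lhopital_right_0)
      show "(flux h \<longlongrightarrow> 0) (at_right 0)"
        using DERIV_continuous[OF flux_deriv[OF h, of 0]] by (simp add: continuous_within at0 flux_def)
      show "((\<lambda>r::real. r ^ n) \<longlongrightarrow> 0) (at_right 0)"
        using n3 by (auto intro!: tendsto_eq_intros)
      have ev: "\<forall>\<^sub>F r in at_right (0::real). 0 < r \<and> r < 1"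
        by (rule eventually_at_right_less[THEN eventually_conj]) (auto intro: eventually_at_rightI[of 0 1])
      then show "\<forall>\<^sub>F r in at_right (0::real). r ^ n \<noteq> 0"
        by eventually_elim simp
      show "\<forall>\<^sub>F r in at_right (0::real). real n * r ^ (n - 1) \<noteq> 0"
        using ev by eventually_elim (use n3 in simp)
      show "\<forall>\<^sub>F r in at_right 0. (flux h has_real_derivative weight r * h r) (at r)"
        using ev
      proof eventually_elim
        case (elim r)
        then show ?case using flux_deriv[OF h, of r] by (simp add: at_within_Icc_at)
      qed
      show "\<forall>\<^sub>F r in at_right 0. ((\<lambda>r. r ^ n) has_real_derivative real n * r ^ (n - 1)) (at (r::real))"
        by (intro always_eventually allI) (auto intro!: derivative_eq_intros)
      have "((\<lambda>r. exp (- G r) * h r / n) \<longlongrightarrow> exp (- G 0) * h 0 / n) (at_right 0)"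
        using continuous_G h n3 unfolding at0[symmetric]
        by (intro tendsto_intros) (auto simp: continuous_on_def)
      then show "((\<lambda>r. weight r * h r / (real n * r ^ (n - 1))) \<longlongrightarrow> exp (- G 0) * h 0 / n) (at_right 0)"
        by (rule Lim_transform_eventually)
           (use ev in eventually_elim, simp add: weight_def)
    qed
    moreover have "((\<lambda>r. exp (G r)) \<longlongrightarrow> exp (G 0)) (at_right 0)"
      using continuous_G unfolding at0[symmetric] by (intro tendsto_intros) (auto simp: continuous_on_def)
    ultimately have lim: "((\<lambda>r. exp (G r) * (flux h r / r ^ n)) \<longlongrightarrow> exp (G 0) * (exp (- G 0) * h 0 / n)) (at_right 0)"
      by (intro tendsto_mult)
    have eq0: "exp (G 0) * (exp (- G 0) * h 0 / n) = slope h 0"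
      by (simp add: slope_def exp_minus)
    have "\<forall>\<^sub>F r in at_right 0. exp (G r) * (flux h r / r ^ n) = slope h r"
      using eventually_at_right_less[of "0::real"]
    proof eventually_elim
      case (elim r)
      then show ?case unfolding slope_def weight_times_id by (simp add: exp_minus field_simps)
    qed
    then have "(slope h \<longlongrightarrow> slope h 0) (at_right 0)"
      by (rule Lim_transform_eventually[OF lim[unfolded eq0]])
    then show ?thesis using True by (simp add: continuous_within at0)
  qed
  then show ?thesis by (simp add: continuous_on_eq_continuous_within)
qed

lemma profile_potential:
  assumes h: "continuous_on {0..1} h"
  shows "profile h (potential h) (slope h)"
  unfolding profile_def
proof (intro conjI ballI)
  show "continuous_on {0..1} (slope h)" by (rule continuous_slope[OF h])
  show "real n * slope h 0 = h 0" using n3 by (simp add: slope_def)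
  show "potential h 1 = 0" by (simp add: potential_def)
  fix r :: real assume r: "r \<in> {0..1}"
  show "(potential h has_real_derivative - (r * slope h r)) (at r within {0..1})"
    unfolding potential_def[abs_def]
    by (rule integral_has_real_derivative'[OF _ r]) (intro continuous_intros continuous_slope h)
  have "weight r * (r * slope h r) = flux h r" if "r \<ge> 0" for r
    using that weight_pos[of r] by (cases "r = 0") (auto simp: slope_def flux_def)
  then show "((\<lambda>r. weight r * (r * slope h r)) has_real_derivative weight r * h r) (at r within {0..1})"
    by (intro has_field_derivative_transform_within[OF flux_deriv[OF h r], of 1]) (use r in auto)
qed

lemma integrable_weight_times:
  assumes "continuous_on {0..1} h" "r \<in> {0..1}"
  shows "(\<lambda>t. weight t * h t) integrable_on {0..r}"
proof -
  have "continuous_on {0..1} (\<lambda>t. weight t * h t)"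
    by (intro continuous_intros continuous_weight assms)
  then show ?thesis
    using assms(2) by (intro integrable_continuous_interval) (auto intro: continuous_on_subset)
qed

lemma integrable_times_slope:
  assumes "continuous_on {0..1} h" "r \<in> {0..1}"
  shows "(\<lambda>t. t * slope h t) integrable_on {r..1}"
proof -
  have "continuous_on {0..1} (\<lambda>t. t * slope h t)"
    by (intro continuous_intros continuous_slope assms)
  then show ?thesis
    using assms(2) by (intro integrable_continuous_interval) (auto intro: continuous_on_subset)
qed

lemma flux_mono:
  assumes "continuous_on {0..1} h" "continuous_on {0..1} k" "\<And>t. t \<in> {0..1} \<Longrightarrow> h t \<le> k t" "r \<in> {0..1}"
  shows "flux h r \<le> flux k r"
  unfolding flux_def
proof (rule integral_le)
  show "(\<lambda>t. weight t * h t) integrable_on {0..r}" "(\<lambda>t. weight t * k t) integrable_on {0..r}"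
    using assms by (simp_all add: integrable_weight_times)
  show "weight t * h t \<le> weight t * k t" if "t \<in> {0..r}" for t
    using that assms(3,4) by (intro mult_left_mono weight_nonneg) auto
qed

lemma slope_mono:
  assumes "continuous_on {0..1} h" "continuous_on {0..1} k" "\<And>t. t \<in> {0..1} \<Longrightarrow> h t \<le> k t" "r \<in> {0..1}"
  shows "slope h r \<le> slope k r"
  using flux_mono[OF assms] assms(3)[of 0] assms(4) weight_nonneg[of r] n3
  by (auto simp: slope_def divide_right_mono)

lemma potential_mono:
  assumes "continuous_on {0..1} h" "continuous_on {0..1} k" "\<And>t. t \<in> {0..1} \<Longrightarrow> h t \<le> k t" "r \<in> {0..1}"
  shows "potential h r \<le> potential k r"
  unfolding potential_def
proof (rule integral_le)
  show "(\<lambda>s. s * slope h s) integrable_on {r..1}" "(\<lambda>s. s * slope k s) integrable_on {r..1}"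
    using assms by (simp_all add: integrable_times_slope)
  show "s * slope h s \<le> s * slope k s" if "s \<in> {r..1}" for s
    using that assms(4) by (intro mult_left_mono slope_mono[OF assms(1,2,3)]) auto
qed

lemma flux_pos:
  assumes "continuous_on {0..1} h" "\<And>t. t \<in> {0..1} \<Longrightarrow> 0 < h t" "r \<in> {0<..1}"
  shows "0 < flux h r"
proof -
  obtain x where x: "0 < x" "x < r" "flux h r - flux h 0 = (r - 0) * (weight x * h x)"
    using mean_value_within[of 0 r "{0..1}" "flux h" "\<lambda>x. weight x * h x"] flux_deriv[OF assms(1)] assms(3)
    by auto
  then have "0 < (r - 0) * (weight x * h x)"
    using assms(2)[of x] assms(3) weight_pos[of x] by simp
  then show ?thesis using x by (simp add: flux_def)
qed

lemma slope_pos: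
  assumes "continuous_on {0..1} h" "\<And>t. t \<in> {0..1} \<Longrightarrow> 0 < h t" "r \<in> {0..1}"
  shows "0 < slope h r"
  using flux_pos[OF assms(1,2), of r] assms weight_pos[of r] n3
  by (cases "r = 0") (auto simp: slope_def)

lemma potential_pos:
  assumes h: "continuous_on {0..1} h" "\<And>t. t \<in> {0..1} \<Longrightarrow> 0 < h t" and r: "r \<in> {0..<1}"
  shows "0 < potential h r"
proof -
  note P = profile_potential[OF h(1)]
  obtain x where x: "r < x" "x < 1" "potential h 1 - potential h r = (1 - r) * - (x * slope h x)"
    using mean_value_within[of r 1 "{0..1}" "potential h" "\<lambda>x. - (x * slope h x)"] profileD(4)[OF P] r
    by auto
  then have "0 < (1 - r) * (x * slope h x)"
    using slope_pos[OF h, of x] r by simp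
  then show ?thesis using x by (simp add: potential_def)
qed

end

section \<open>Radial functions in space\<close>

context radial_weight
begin

text \<open>The Hessian of \<open>W(\<bar>x\<bar>)\<close> is \<open>- m \<delta>\<^sub>i\<^sub>j - r m'(r) x\<^sub>i x\<^sub>j / r\<^sup>2\<close>, with \<open>r m'(r)\<close> taken from
  the equation. At \<open>x = 0\<close> the convention \<open>0 / 0 = 0\<close> gives the right value, since \<open>r m'(r)\<close> tends to \<open>0\<close>
  there.\<close>

definition radial_hessian :: "(real \<Rightarrow> real) \<Rightarrow> (real \<Rightarrow> real) \<Rightarrow> 'a \<Rightarrow> 'a \<Rightarrow> 'a::euclidean_space \<Rightarrow> real" where
  "radial_hessian h m i j x = - m (norm x) * (i \<bullet> j)
     - (h (norm x) - (real n - norm x * G1 (norm x)) * m (norm x)) * ((x \<bullet> i) * (x \<bullet> j) / (norm x)\<^sup>2)"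

lemma norm_compose_deriv:
  fixes x :: "'a::euclidean_space"
  assumes "x \<in> cball 0 1" "x \<noteq> 0" "(g has_real_derivative d) (at (norm x) within {0..1})"
  shows "((\<lambda>x. g (norm x)) has_derivative (\<lambda>k. (x \<bullet> k) / norm x * d)) (at x within cball 0 1)"
proof -
  have "(norm has_derivative (\<lambda>k. (x \<bullet> k) / norm x)) (at x within cball 0 1)"
    using has_derivative_at_withinI[OF has_derivative_norm[OF assms(2)]]
    by (simp add: sgn_div_norm inverse_eq_divide inner_commute)
  moreover have "(g has_derivative (*) d) (at (norm x) within norm ` cball (0::'a) 1)"
    using assms(3) unfolding has_field_derivative_def by (rule has_derivative_subset) auto
  ultimately have "((\<lambda>x. g (norm x)) has_derivative (\<lambda>k. d * ((x \<bullet> k) / norm x))) (at x within cball 0 1)"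
    by (rule has_derivative_in_compose)
  then show ?thesis by (simp add: mult.commute)
qed

lemma radial_first_deriv:
  fixes x :: "'a::euclidean_space"
  assumes P: "profile h W m" and x: "x \<in> cball 0 1"
  shows "((\<lambda>x. W (norm x)) has_derivative
      (\<lambda>k. \<Sum>i\<in>Basis. (k \<bullet> i) * (- m (norm x) * (x \<bullet> i)))) (at x within cball 0 1)"
proof -
  have eq: "(\<Sum>i\<in>Basis. (k \<bullet> i) * (- m (norm x) * (x \<bullet> i))) = - m (norm x) * (k \<bullet> x)" for k
    unfolding euclidean_inner[of k x] sum_distrib_left by (intro sum.cong) auto
  have r: "norm x \<in> {0..1}" using x by simp
  show ?thesis
  proof (cases "x = 0")
    case False
    have "(\<lambda>k. (x \<bullet> k) / norm x * - (norm x * m (norm x))) = (\<lambda>k. - m (norm x) * (k \<bullet> x))"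
      using False by (auto simp: inner_commute)
    then show ?thesis
      using norm_compose_deriv[OF x False profileD(4)[OF P r]] by (simp only: eq)
  next
    case True
    have W0: "(W has_derivative (\<lambda>_. 0)) (at 0 within {0..1})"
      using profileD(4)[OF P, of 0] by (simp add: has_field_derivative_def lambda_zero)
    have "((\<lambda>x::'a. W (norm x)) has_derivative (\<lambda>_. 0)) (at 0 within cball 0 1)"
      unfolding has_derivative_within_alt
    proof (intro conjI allI impI)
      fix e :: real assume "e > 0"
      with W0 obtain d where d: "d > 0" "\<And>y. y \<in> {0..1} \<Longrightarrow> norm (y - 0) < d \<Longrightarrow>
          norm (W y - W 0 - 0) \<le> e * norm (y - 0)"
        unfolding has_derivative_within_alt by blast
      then show "\<exists>d>0. \<forall>y\<in>cball 0 1. norm (y - (0::'a)) < d \<longrightarrow>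
          norm (W (norm y) - W (norm (0::'a)) - 0) \<le> e * norm (y - 0)"
        by (intro exI[of _ d]) auto
    qed simp
    then show ?thesis unfolding eq using True by simp
  qed
qed

lemma radial_second_deriv:
  fixes x i :: "'a::euclidean_space"
  assumes P: "profile h W m" and x: "x \<in> cball 0 1" and i: "i \<in> Basis"
  shows "((\<lambda>x. - m (norm x) * (x \<bullet> i)) has_derivative
      (\<lambda>k. \<Sum>j\<in>Basis. (k \<bullet> j) * radial_hessian h m i j x)) (at x within cball 0 1)"
proof -
  define q where "q = h (norm x) - (real n - norm x * G1 (norm x)) * m (norm x)"
  have eq: "(\<Sum>j\<in>Basis. (k \<bullet> j) * radial_hessian h m i j x) =
      - m (norm x) * (k \<bullet> i) - q * ((x \<bullet> i) * (k \<bullet> x) / (norm x)\<^sup>2)" for k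
    unfolding euclidean_inner[of k x] euclidean_inner[of k i] radial_hessian_def q_def[symmetric]
      sum_distrib_left sum_divide_distrib sum_subtractf[symmetric]
    by (intro sum.cong refl) (simp add: algebra_simps)
  have r: "norm x \<in> {0..1}" using x by simp
  show ?thesis
  proof (cases "x = 0")
    case False
    have "((\<lambda>x. m (norm x)) has_derivative (\<lambda>k. (x \<bullet> k) / norm x * (q / norm x))) (at x within cball 0 1)"
      unfolding q_def using False x by (intro norm_compose_deriv profile_slope_deriv[OF P]) auto
    then have "((\<lambda>x. - m (norm x) * (x \<bullet> i)) has_derivative
       (\<lambda>k. - m (norm x) * (k \<bullet> i) + - ((x \<bullet> k) / norm x * (q / norm x)) * (x \<bullet> i))) (at x within cball 0 1)"
      by (auto intro!: derivative_eq_intros)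
    moreover have "- m (norm x) * (k \<bullet> i) + - ((x \<bullet> k) / norm x * (q / norm x)) * (x \<bullet> i)
       = - m (norm x) * (k \<bullet> i) - q * ((x \<bullet> i) * (k \<bullet> x) / (norm x)\<^sup>2)" for k
      by (simp add: power2_eq_square inner_commute)
    ultimately show ?thesis by (simp only: eq)
  next
    case True
    have "((\<lambda>x::'a. - m (norm x) * (x \<bullet> i)) has_derivative (\<lambda>k. - m 0 * (k \<bullet> i))) (at 0 within cball 0 1)"
      unfolding has_derivative_within_alt
    proof (intro conjI allI impI)
      show "bounded_linear (\<lambda>k. - m 0 * (k \<bullet> i))"
        by (intro bounded_linear_intros)
      fix e :: real assume "e > 0"
      with profileD(1)[OF P] obtain d where d: "d > 0" "\<And>y. y \<in> {0..1} \<Longrightarrow> dist y 0 < d \<Longrightarrow>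
          dist (m y) (m 0) < e"
        unfolding continuous_on_iff by (metis atLeastAtMost_iff order_refl zero_le_one)
      have "norm (- m (norm y) * (y \<bullet> i) - - m (norm (0::'a)) * (0 \<bullet> i) - - m 0 * ((y - 0) \<bullet> i))
          \<le> e * norm (y - 0)" if "y \<in> cball 0 1" "norm (y - 0) < d" for y :: 'a
      proof -
        have "\<bar>m (norm y) - m 0\<bar> \<le> e" using d(2)[of "norm y"] that by (auto simp: dist_real_def)
        then have "\<bar>m (norm y) - m 0\<bar> * \<bar>y \<bullet> i\<bar> \<le> e * norm y"
          using Basis_le_norm[OF i, of y] by (intro mult_mono) auto
        moreover have "- m (norm y) * (y \<bullet> i) - - m (norm (0::'a)) * (0 \<bullet> i) - - m 0 * ((y - 0) \<bullet> i)
            = - ((m (norm y) - m 0) * (y \<bullet> i))" by (simp add: algebra_simps)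
        ultimately show ?thesis by (simp add: abs_mult)
      qed
      with d show "\<exists>d>0. \<forall>y\<in>cball 0 1. norm (y - (0::'a)) < d \<longrightarrow>
          norm (- m (norm y) * (y \<bullet> i) - - m (norm (0::'a)) * (0 \<bullet> i) - - m 0 * ((y - 0) \<bullet> i))
          \<le> e * norm (y - 0)"
        by blast
    qed
    then show ?thesis unfolding eq using True by simp
  qed
qed

lemma continuous_radial_hessian:
  fixes i j :: "'a::euclidean_space"
  assumes P: "profile h W m" and h: "continuous_on {0..1} h" and i: "i \<in> Basis" "j \<in> Basis"
  shows "continuous_on (cball 0 1) (radial_hessian h m i j)"
proof -
  define q where "q r = h r - (real n - r * G1 r) * m r" for r
  have norm_cont: "continuous_on (cball 0 1) (\<lambda>x::'a. g (norm x))" if "continuous_on {0..1} g" for g :: "real \<Rightarrow> real"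
    by (rule continuous_on_compose2[OF that]) (auto intro!: continuous_intros)
  have "continuous_on {0..1} q"
    unfolding q_def by (intro continuous_intros h continuous_G1 profileD(1)[OF P])
  then have cq: "continuous_on (cball 0 1) (\<lambda>x::'a. q (norm x))" by (rule norm_cont)
  have q0: "q 0 = 0" using profileD(2)[OF P] by (simp add: q_def)
  have "continuous (at x within cball 0 1) (\<lambda>x. q (norm x) * ((x \<bullet> i) * (x \<bullet> j) / (norm x)\<^sup>2))"
    if x: "x \<in> cball 0 1" for x :: 'a
  proof (cases "x = 0")
    case False
    then show ?thesis
      using cq x by (auto intro!: continuous_intros simp: continuous_on_eq_continuous_within)
  next
    case True
    have "((\<lambda>x::'a. q (norm x)) \<longlongrightarrow> q (norm (0::'a))) (at 0 within cball 0 1)"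
      using bspec[OF cq[unfolded continuous_on_def], of 0] by simp
    then have lim: "((\<lambda>x::'a. \<bar>q (norm x)\<bar>) \<longlongrightarrow> 0) (at 0 within cball 0 1)"
      using q0 by (simp add: tendsto_rabs_zero)
    have "norm (q (norm y) * ((y \<bullet> i) * (y \<bullet> j) / (norm y)\<^sup>2)) \<le> \<bar>q (norm y)\<bar>" for y :: 'a
    proof (cases "y = 0")
      case False
      have "\<bar>y \<bullet> i\<bar> * \<bar>y \<bullet> j\<bar> \<le> norm y * norm y"
        using Basis_le_norm i by (intro mult_mono) auto
      then have "\<bar>(y \<bullet> i) * (y \<bullet> j) / (norm y)\<^sup>2\<bar> \<le> 1"
        using False by (simp add: abs_mult power2_eq_square)
      then show ?thesis
        by (metis abs_ge_zero abs_mult mult.right_neutral mult_left_mono real_norm_def)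
    qed simp
    then have "((\<lambda>x. q (norm x) * ((x \<bullet> i) * (x \<bullet> j) / (norm x)\<^sup>2)) \<longlongrightarrow> 0) (at 0 within cball 0 1)"
      by (intro Lim_null_comparison[OF always_eventually lim]) auto
    then show ?thesis using True by (simp add: continuous_within)
  qed
  then have "continuous_on (cball 0 1) (\<lambda>x. q (norm x) * ((x \<bullet> i) * (x \<bullet> j) / (norm x)\<^sup>2))"
    by (simp add: continuous_on_eq_continuous_within)
  moreover have "continuous_on (cball 0 1) (\<lambda>x::'a. - m (norm x) * (i \<bullet> j))"
    by (intro continuous_intros norm_cont profileD(1)[OF P])
  ultimately show ?thesis
    unfolding radial_hessian_def[abs_def] q_def[symmetric] by (rule continuous_on_diff[rotated])
qed

lemma Ck_on_2_radial:
  assumes P: "profile h W m" and h: "continuous_on {0..1} h"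
  shows "Ck_on 2 (cball 0 1) (\<lambda>x::'a::euclidean_space. W (norm x))"
proof -
  have "Ck_on (Suc 0) (cball 0 1) (\<lambda>x. - m (norm x) * (x \<bullet> i))" if "i \<in> Basis" for i :: 'a
    unfolding Ck_on.simps(2)
    by (intro exI[of _ "radial_hessian h m i"] conjI ballI)
       (use radial_second_deriv[OF P _ that] continuous_radial_hessian[OF P h that] in auto)
  then have "Ck_on (Suc (Suc 0)) (cball 0 1) (\<lambda>x::'a. W (norm x))"
    unfolding Ck_on.simps(2)[of "Suc 0"]
    by (intro exI[of _ "\<lambda>i x. - m (norm x) * (x \<bullet> i)"] conjI ballI radial_first_deriv[OF P])
  then show ?thesis by (simp only: numeral_2_eq_2)
qed

text \<open>The trace of the Hessian is \<open>- n m - r m'(r)\<close>, in which the \<open>n m\<close> terms cancel; at the origin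
  this is the normalisation \<open>n m(0) = h(0)\<close>.\<close>

lemma radial_derivs:
  fixes x :: "'a::euclidean_space"
  assumes P: "profile h W m" and x: "x \<in> ball 0 1" and dim: "DIM('a) = n"
  shows "grad (\<lambda>x. W (norm x)) x = - m (norm x) *\<^sub>R x"
    and "laplacian (\<lambda>x. W (norm x)) x = - h (norm x) - norm x * G1 (norm x) * m (norm x)"
proof -
  have at: "at y within cball 0 1 = at y" if "y \<in> ball 0 1" for y :: 'a
    using that by (intro at_within_interior) simp
  have p1: "partial_deriv i (\<lambda>x. W (norm x)) y = - m (norm y) * (y \<bullet> i)"
    if i: "i \<in> Basis" and y: "y \<in> ball 0 1" for i y :: 'a
    using radial_first_deriv[OF P, of y] y at[OF y] by (intro partial_deriv_eqI[OF _ i]) auto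
  have "grad (\<lambda>x. W (norm x)) x = (\<Sum>i\<in>Basis. - m (norm x) *\<^sub>R (x \<bullet> i) *\<^sub>R i)"
    unfolding grad_def using x by (intro sum.cong) (auto simp: p1)
  also have "\<dots> = - m (norm x) *\<^sub>R x"
    unfolding scaleR_sum_right[symmetric] euclidean_representation ..
  finally show "grad (\<lambda>x. W (norm x)) x = - m (norm x) *\<^sub>R x" .
  define q where "q = h (norm x) - (real n - norm x * G1 (norm x)) * m (norm x)"
  have "partial_deriv i (partial_deriv i (\<lambda>x. W (norm x))) x = radial_hessian h m i i x"
    if i: "i \<in> Basis" for i :: 'a
  proof -
    have "partial_deriv i (partial_deriv i (\<lambda>x. W (norm x))) x = partial_deriv i (\<lambda>x. - m (norm x) * (x \<bullet> i)) x"
      by (rule partial_deriv_cong[OF open_ball x p1[OF i]])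
    also have "\<dots> = radial_hessian h m i i x"
      using radial_second_deriv[OF P _ i, of x] x at[OF x] by (intro partial_deriv_eqI[OF _ i]) auto
    finally show ?thesis .
  qed
  then have "laplacian (\<lambda>x. W (norm x)) x = (\<Sum>i\<in>Basis. radial_hessian h m i i x)"
    unfolding laplacian_def by (intro sum.cong) auto
  also have "\<dots> = (\<Sum>i\<in>(Basis::'a set). - m (norm x)) - q * ((\<Sum>i\<in>Basis. (x \<bullet> i) * (x \<bullet> i)) / (norm x)\<^sup>2)"
    unfolding radial_hessian_def q_def[symmetric] sum_divide_distrib sum_distrib_left sum_subtractf[symmetric]
    by (intro sum.cong) (auto simp: inner_same_Basis)
  also have "\<dots> = - (real n * m (norm x)) - q * ((norm x)\<^sup>2 / (norm x)\<^sup>2)"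
    by (simp add: euclidean_inner[symmetric] dim power2_norm_eq_inner)
  also have "\<dots> = - h (norm x) - norm x * G1 (norm x) * m (norm x)"
    using profileD(2)[OF P] by (cases "x = 0") (auto simp: q_def power2_eq_square algebra_simps)
  finally show "laplacian (\<lambda>x. W (norm x)) x =
     - h (norm x) - norm x * G1 (norm x) * m (norm x)" .
qed

end

section \<open>Radial solutions below a supersolution\<close>

lemma (in radial_weight) profile_cong:
  assumes "profile h W m" "\<And>r. r \<in> {0..1} \<Longrightarrow> h r = k r"
  shows "profile k W m"
  using assms by (auto simp: profile_def)

locale radial_drift = radial_weight "DIM('a)" G G1 G2 K
  for G G1 G2 :: "real \<Rightarrow> real" and K :: real and \<gamma> :: "'a::euclidean_space \<Rightarrow> real" +
  assumes \<gamma>_radial: "\<And>x. x \<in> cball 0 1 \<Longrightarrow> \<gamma> x = G (norm x)"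
    and \<gamma>_differentiable: "\<And>x. x \<in> ball 0 1 \<Longrightarrow> \<gamma> differentiable (at x)"
begin

text \<open>Both sides are the derivative of \<open>\<gamma>(t x) = G(t \<bar>x\<bar>)\<close> at \<open>t = 1\<close>.\<close>

lemma drift_radial:
  assumes x: "x \<in> ball 0 1"
  shows "grad \<gamma> x \<bullet> x = norm x * G1 (norm x)"
proof (cases "x = 0")
  case False
  have r: "0 < norm x" "norm x < 1" using x False by auto
  have "((\<lambda>t. t *\<^sub>R x) has_derivative (\<lambda>s. s *\<^sub>R x)) (at 1)"
    by (auto intro!: derivative_eq_intros)
  moreover have "(\<gamma> has_derivative frechet_derivative \<gamma> (at x)) (at (1 *\<^sub>R x))"
    using frechet_derivative_worksI[OF \<gamma>_differentiable[OF x]] by simp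
  ultimately have "((\<lambda>t. \<gamma> (t *\<^sub>R x)) has_derivative (\<lambda>s. frechet_derivative \<gamma> (at x) (s *\<^sub>R x))) (at 1)"
    by (rule has_derivative_compose)
  moreover have "frechet_derivative \<gamma> (at x) (s *\<^sub>R x) = (grad \<gamma> x \<bullet> x) * s" for s
    unfolding grad_inner[OF \<gamma>_differentiable[OF x], symmetric] by (simp add: mult.commute)
  ultimately have 1: "((\<lambda>t. \<gamma> (t *\<^sub>R x)) has_real_derivative grad \<gamma> x \<bullet> x) (at 1)"
    by (simp add: has_field_derivative_def)
  have "(G has_real_derivative G1 (1 * norm x)) (at (1 * norm x))"
    using G_deriv[of "norm x"] r by (simp add: at_within_Icc_at)
  moreover have "((\<lambda>t. t * norm x) has_real_derivative norm x) (at 1)"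
    by (auto intro!: derivative_eq_intros)
  ultimately have "((\<lambda>t. G (t * norm x)) has_real_derivative G1 (1 * norm x) * norm x) (at 1)"
    by (rule DERIV_chain2)
  then have "((\<lambda>t. \<gamma> (t *\<^sub>R x)) has_real_derivative G1 (1 * norm x) * norm x) (at 1)"
  proof (rule has_field_derivative_transform_within_open[where S = "{0<..<1 / norm x}"])
    show "open {0<..<1 / norm x}" by simp
    show "1 \<in> {0<..<1 / norm x}" using r by simp
    show "G (t * norm x) = \<gamma> (t *\<^sub>R x)" if "t \<in> {0<..<1 / norm x}" for t
      using that r by (subst \<gamma>_radial) (auto simp: field_simps)
  qed
  from DERIV_unique[OF 1 this] show ?thesis by simp
qed simp

lemma radial_equation:
  assumes P: "profile h W m" and x: "x \<in> ball 0 1"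
  shows "- laplacian (\<lambda>x. W (norm x)) x + grad \<gamma> x \<bullet> grad (\<lambda>x. W (norm x)) x = h (norm x)"
  unfolding radial_derivs[OF P x refl] using drift_radial[OF x] by (simp add: algebra_simps)

text \<open>Lowering \<open>h\<close> by a constant \<open>\<epsilon>\<close> makes the differential inequality strict and lowers the potential
  by a multiple of \<open>\<epsilon>\<close>, which then tends to \<open>0\<close>.\<close>

lemma supersolution_dominates:
  assumes v: "Ck_on 2 (cball 0 1) v" and h: "continuous_on {0..1} h"
    and super: "\<And>x. x \<in> ball 0 1 \<Longrightarrow> h (norm x) \<le> - laplacian v x + grad \<gamma> x \<bullet> grad v x"
    and bd: "\<And>x. x \<in> sphere 0 1 \<Longrightarrow> 0 \<le> v x" and x: "x \<in> cball 0 1"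
  shows "potential h (norm x) \<le> v x"
proof -
  have one: "continuous_on {0..1} (\<lambda>_::real. 1::real)" by (rule continuous_on_const)
  have r: "norm x \<in> {0..1}" using x by simp
  have "potential h (norm x) - \<epsilon> * potential (\<lambda>_. 1) (norm x) \<le> v x" if "\<epsilon> > 0" for \<epsilon> :: real
  proof -
    define k where "k = (\<lambda>t. h t - \<epsilon>)"
    have k: "continuous_on {0..1} k" unfolding k_def by (intro continuous_intros h)
    have flux: "flux k s = flux h s - \<epsilon> * flux (\<lambda>_. 1) s" if s: "s \<in> {0..1}" for s
    proof -
      have "flux k s = integral {0..s} (\<lambda>t. weight t * h t - \<epsilon> * (weight t * 1))"
        by (simp add: flux_def k_def algebra_simps)
      also have "\<dots> = flux h s - \<epsilon> * flux (\<lambda>_. 1) s"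
        unfolding flux_def using integrable_weight_times[OF h s] integrable_weight_times[OF one s]
        by (subst integral_diff) (auto intro: integrable_on_mult_right)
      finally show ?thesis .
    qed
    have slope: "slope k s = slope h s - \<epsilon> * slope (\<lambda>_. 1) s" if s: "s \<in> {0..1}" for s
      unfolding slope_def flux[OF s] by (simp add: diff_divide_distrib k_def)
    have "potential k (norm x) = integral {norm x..1} (\<lambda>s. s * slope h s - \<epsilon> * (s * slope (\<lambda>_. 1) s))"
      unfolding potential_def
    proof (rule integral_cong)
      fix s assume "s \<in> {norm x..1}"
      then have "s \<in> {0..1}" using norm_ge_zero[of x] by (meson atLeastAtMost_iff order_trans)
      then show "s * slope k s = s * slope h s - \<epsilon> * (s * slope (\<lambda>_. 1) s)"
        by (simp add: slope algebra_simps)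
    qed
    also have "\<dots> = potential h (norm x) - \<epsilon> * potential (\<lambda>_. 1) (norm x)"
      unfolding potential_def using integrable_times_slope[OF h r] integrable_times_slope[OF one r]
      by (subst integral_diff) (auto intro: integrable_on_mult_right)
    finally have eq: "potential k (norm x) = potential h (norm x) - \<epsilon> * potential (\<lambda>_. 1) (norm x)" .
    note P = profile_potential[OF k]
    have "potential k (norm x) \<le> v x"
    proof (rule strict_comparison_principle[OF v Ck_on_2_radial[OF P k], where c = "grad \<gamma>"])
      fix y :: 'a assume y: "y \<in> ball 0 1"
      show "- laplacian (\<lambda>x. potential k (norm x)) y + grad \<gamma> y \<bullet> grad (\<lambda>x. potential k (norm x)) y
          < - laplacian v y + grad \<gamma> y \<bullet> grad v y"
        unfolding radial_equation[OF P y] using super[OF y] that by (simp add: k_def)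
    qed (use bd x profileD(3)[OF P] in auto)
    then show ?thesis using eq by simp
  qed
  then have ev: "\<forall>\<^sub>F \<epsilon> in at_right 0. potential h (norm x) - \<epsilon> * potential (\<lambda>_. 1) (norm x) \<le> v x"
    by (intro eventually_at_right_less[of "0::real", THEN eventually_mono]) auto
  have "((\<lambda>\<epsilon>. potential h (norm x) - \<epsilon> * potential (\<lambda>_. 1) (norm x)) \<longlongrightarrow>
      potential h (norm x) - 0 * potential (\<lambda>_. 1) (norm x)) (at_right 0)"
    by (intro tendsto_intros)
  from tendsto_upperbound[OF this ev] show ?thesis by simp
qed

end

locale radial_problem = radial_drift G G1 G2 K \<gamma>
  for G G1 G2 :: "real \<Rightarrow> real" and K :: real and \<gamma> :: "'a::euclidean_space \<Rightarrow> real" +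
  fixes f :: "real \<Rightarrow> real"
  assumes f_continuous: "continuous_on {0..<1} f"
    and f_pos: "\<And>t. t \<in> {0..<1} \<Longrightarrow> 0 < f t"
    and f_mono: "mono_on {0..<1} f"
begin

text \<open>The radial form of a regular solution, so that \<open>0 \<le> W < 1\<close> also at the boundary.\<close>

definition radial_solution :: "real \<Rightarrow> (real \<Rightarrow> real) \<Rightarrow> (real \<Rightarrow> real) \<Rightarrow> bool" where
  "radial_solution l W m \<longleftrightarrow>
     profile (\<lambda>r. l * f (W r)) W m \<and> (\<forall>r\<in>{0..1}. 0 \<le> W r \<and> W r < 1) \<and> (\<forall>r\<in>{0..<1}. 0 < W r)"

lemma radial_solutionD:
  assumes "radial_solution l W m"
  shows "profile (\<lambda>r. l * f (W r)) W m" "r \<in> {0..1} \<Longrightarrow> 0 \<le> W r" "r \<in> {0..1} \<Longrightarrow> W r < 1"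
    "r \<in> {0..<1} \<Longrightarrow> 0 < W r" "continuous_on {0..1} W" "continuous_on {0..1} (\<lambda>r. l * f (W r))"
proof -
  show P: "profile (\<lambda>r. l * f (W r)) W m" "r \<in> {0..1} \<Longrightarrow> 0 \<le> W r" "r \<in> {0..1} \<Longrightarrow> W r < 1"
    "r \<in> {0..<1} \<Longrightarrow> 0 < W r" using assms by (auto simp: radial_solution_def)
  show W: "continuous_on {0..1} W" by (rule DERIV_continuous_on[OF profileD(4)[OF P(1)]])
  show "continuous_on {0..1} (\<lambda>r. l * f (W r))"
    by (intro continuous_intros continuous_on_compose2[OF f_continuous W])
       (use assms in \<open>auto simp: radial_solution_def\<close>)
qed

lemma regular_solution_radial:
  assumes R: "radial_solution l W m"
  shows "regular_solution (grad \<gamma>) f l (\<lambda>x. W (norm x))"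
  using Ck_on_2_radial[OF radial_solutionD(1,6)[OF R]] radial_equation[OF radial_solutionD(1)[OF R]]
    radial_solutionD(3,4)[OF R] profileD(3)[OF radial_solutionD(1)[OF R]]
  by (auto simp: regular_solution_def)

text \<open>Monotone iteration from \<open>0\<close>. Each iterate is the potential of the nonlinearity at the previous
  one, hence radial, and it stays below \<open>v\<close> by comparison because \<open>f\<close> is nondecreasing. Monotone
  convergence in both integrations shows that the limit is the potential of its own nonlinearity. The
  maximum of \<open>v\<close> keeps all iterates in a compact part of \<open>[0, 1)\<close>, where \<open>f\<close> is bounded.\<close>

lemma radial_solution_below:
  assumes l: "l > 0" and v: "Ck_on 2 (cball 0 1) v"
    and v01: "\<And>x. x \<in> cball 0 1 \<Longrightarrow> 0 \<le> v x \<and> v x < 1"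
    and super: "\<And>x. x \<in> ball 0 1 \<Longrightarrow> l * f (v x) \<le> - laplacian v x + grad \<gamma> x \<bullet> grad v x"
  obtains W m where "radial_solution l W m" "\<And>x. x \<in> cball 0 1 \<Longrightarrow> W (norm x) \<le> v x"
proof -
  obtain x1 where x1: "x1 \<in> cball 0 1" "\<And>x. x \<in> cball 0 1 \<Longrightarrow> v x \<le> v x1"
    using continuous_attains_sup[of "cball 0 1" v] Ck_on_2_continuous[OF v] by auto
  define M where "M = v x1"
  have M: "0 \<le> M" "M < 1" "\<And>x. x \<in> cball 0 1 \<Longrightarrow> v x \<le> M" using x1 v01 by (auto simp: M_def)
  obtain e :: 'a where e: "e \<in> Basis" using nonempty_Basis by blast
  have e_norm: "r *\<^sub>R e \<in> cball 0 1" "norm (r *\<^sub>R e) = r" if "r \<in> {0..1}" for r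
    using that e by auto
  define w where "w = rec_nat (\<lambda>_::real. 0) (\<lambda>_ g. potential (\<lambda>r. l * f (g r)))"
  define h where "h k r = l * f (w k r)" for k r
  have w0: "w 0 = (\<lambda>_. 0)" and wS: "w (Suc k) = potential (h k)" for k
    by (simp_all add: w_def h_def[abs_def])
  have main: "continuous_on {0..1} (w k) \<and> (\<forall>x\<in>cball 0 1. 0 \<le> w k (norm x) \<and> w k (norm x) \<le> v x)" for k
  proof (induction k)
    case 0
    then show ?case using v01 by (simp add: w0)
  next
    case (Suc k)
    then have wk: "continuous_on {0..1} (w k)"
      "\<And>x. x \<in> cball 0 1 \<Longrightarrow> 0 \<le> w k (norm x) \<and> w k (norm x) \<le> v x" by auto
    have range: "w k r \<in> {0..<1}" if "r \<in> {0..1}" for r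
      using wk(2)[OF e_norm(1)[OF that]] v01[OF e_norm(1)[OF that]] e_norm(2)[OF that] by auto
    have h: "continuous_on {0..1} (h k)"
      unfolding h_def using range by (intro continuous_intros continuous_on_compose2[OF f_continuous wk(1)]) auto
    have "potential (\<lambda>_. 0) r \<le> potential (h k) r" if "r \<in> {0..1}" for r
      using that l f_pos[OF range] by (intro potential_mono h continuous_on_const) (auto simp: h_def less_imp_le)
    moreover have "potential (\<lambda>_. 0) r = 0" for r
    proof -
      have "slope (\<lambda>_. 0) = (\<lambda>_. 0)" by (auto simp: slope_def flux_def)
      then show ?thesis by (simp add: potential_def)
    qed
    ultimately have "0 \<le> w (Suc k) (norm x)" if "x \<in> cball 0 1" for x :: 'a
      using that by (simp add: wS)
    moreover have "w (Suc k) (norm x) \<le> v x" if x: "x \<in> cball 0 1" for x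
      unfolding wS
    proof (rule supersolution_dominates[OF v h])
      fix y :: 'a assume y: "y \<in> ball 0 1"
      then have "f (w k (norm y)) \<le> f (v y)"
        using range[of "norm y"] v01[of y] wk(2)[of y] by (intro mono_onD[OF f_mono]) auto
      then have "h k (norm y) \<le> l * f (v y)" using l by (simp add: h_def)
      with super[OF y] show "h k (norm y) \<le> - laplacian v y + grad \<gamma> y \<bullet> grad v y" by simp
    qed (use v01 x in auto)
    moreover have "continuous_on {0..1} (w (Suc k))"
      unfolding wS by (rule DERIV_continuous_on[OF profileD(4)[OF profile_potential[OF h]]])
    ultimately show ?case by blast
  qed
  have cont_w: "continuous_on {0..1} (w k)" for k using main by blast
  have w_range: "0 \<le> w k r" "w k r \<le> M" if "r \<in> {0..1}" for k r
  proof -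
    have "0 \<le> w k (norm (r *\<^sub>R e)) \<and> w k (norm (r *\<^sub>R e)) \<le> v (r *\<^sub>R e)"
      using main[of k] e_norm(1)[OF that] by blast
    then show "0 \<le> w k r" "w k r \<le> M"
      using e_norm(2)[OF that] M(3)[OF e_norm(1)[OF that]] by simp_all
  qed
  have w_01: "w k r \<in> {0..<1}" if "r \<in> {0..1}" for k r
    using w_range[OF that, of k] M(2) by simp
  have cont_h: "continuous_on {0..1} (h k)" for k
    unfolding h_def using w_01
    by (intro continuous_intros continuous_on_compose2[OF f_continuous cont_w]) blast
  have h_mono: "h k r \<le> h j r" if "r \<in> {0..1}" "w k r \<le> w j r" for k j r
    unfolding h_def using that(2) l by (intro mult_left_mono mono_onD[OF f_mono] w_01 that(1)) auto
  have w_mono: "w k r \<le> w (Suc k) r" if "r \<in> {0..1}" for k r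
    using that
  proof (induction k arbitrary: r)
    case 0
    then show ?case using w_range(1)[of r "Suc 0"] by (simp add: w0)
  next
    case (Suc k)
    have "potential (h k) r \<le> potential (h (Suc k)) r"
      by (intro potential_mono cont_h h_mono Suc.IH Suc.prems)
    then show ?case by (simp add: wS)
  qed
  define V where "V r = lim (\<lambda>k. w k r)" for r
  have w_lim: "(\<lambda>k. w k r) \<longlonglongrightarrow> V r" if r: "r \<in> {0..1}" for r
  proof -
    have "convergent (\<lambda>k. w k r)"
    proof (rule Bseq_mono_convergent)
      show "Bseq (\<lambda>k. w k r)" using w_range[OF r] by (intro BseqI'[of _ M]) simp
      show "\<forall>m n. m \<le> n \<longrightarrow> w m r \<le> w n r"
        using lift_Suc_mono_le[of "\<lambda>k. w k r"] w_mono[OF r] by blast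
    qed
    then show ?thesis by (simp add: V_def convergent_LIMSEQ_iff)
  qed
  have V_range: "0 \<le> V r" "V r \<le> M" if "r \<in> {0..1}" for r
    using LIMSEQ_le_const[OF w_lim[OF that]] LIMSEQ_le_const2[OF w_lim[OF that]] w_range[OF that] by auto
  define H where "H r = l * f (V r)" for r
  have h_lim: "(\<lambda>k. h k r) \<longlonglongrightarrow> H r" if "r \<in> {0..1}" for r
    unfolding h_def H_def using V_range[OF that] M(2) w_01[OF that]
    by (intro tendsto_intros continuous_on_tendsto_compose[OF f_continuous w_lim[OF that]]) auto
  have h_le: "h k r \<le> l * f M" if "r \<in> {0..1}" for k r
    unfolding h_def using w_range(2)[OF that] M l
    by (intro mult_left_mono mono_onD[OF f_mono] w_01[OF that]) auto
  have h_nonneg: "0 \<le> h k r" if "r \<in> {0..1}" for k r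
    unfolding h_def using l f_pos[OF w_01[OF that, of k]] by auto
  have cM: "continuous_on {0..1} (\<lambda>_::real. l * f M)" "continuous_on {0..1} (\<lambda>_::real. 0::real)"
    by (rule continuous_on_const)+
  have flux_lim: "(\<lambda>k. flux (h k) r) \<longlonglongrightarrow> flux H r" if r: "r \<in> {0..1}" for r
  proof -
    have "(\<lambda>t. weight t * H t) integrable_on {0..r} \<and>
       (\<lambda>k. integral {0..r} (\<lambda>t. weight t * h k t)) \<longlonglongrightarrow> integral {0..r} (\<lambda>t. weight t * H t)"
    proof (rule monotone_convergence_increasing)
      show "(\<lambda>t. weight t * h k t) integrable_on {0..r}" for k
        by (rule integrable_weight_times[OF cont_h r])
      show "weight t * h k t \<le> weight t * h (Suc k) t" if "t \<in> {0..r}" for k t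
        using that r by (intro mult_left_mono h_mono w_mono weight_nonneg) auto
      show "(\<lambda>k. weight t * h k t) \<longlonglongrightarrow> weight t * H t" if "t \<in> {0..r}" for t
        using that r by (intro tendsto_intros h_lim) auto
      have "0 \<le> flux (h k) r \<and> flux (h k) r \<le> flux (\<lambda>_. l * f M) r" for k
        using flux_mono[OF cM(2) cont_h h_nonneg r] flux_mono[OF cont_h cM(1) h_le r]
        by (simp add: flux_def)
      then show "bounded (range (\<lambda>k. integral {0..r} (\<lambda>t. weight t * h k t)))"
        unfolding flux_def by (auto simp: bounded_real intro!: exI)
    qed
    then show ?thesis by (simp add: flux_def)
  qed
  have slope_lim: "(\<lambda>k. slope (h k) r) \<longlonglongrightarrow> slope H r" if r: "r \<in> {0..1}" for r
    using flux_lim[OF r] h_lim[OF r] weight_pos[of r] r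
    by (cases "r = 0") (auto simp: slope_def intro!: tendsto_intros)
  have pot: "(\<lambda>s. s * slope H s) integrable_on {r..1} \<and> (\<lambda>k. w (Suc k) r) \<longlonglongrightarrow> potential H r"
    if r: "r \<in> {0..1}" for r
    unfolding wS potential_def
  proof (rule monotone_convergence_increasing)
    show "(\<lambda>s. s * slope (h k) s) integrable_on {r..1}" for k
      by (rule integrable_times_slope[OF cont_h r])
    show "s * slope (h k) s \<le> s * slope (h (Suc k)) s" if "s \<in> {r..1}" for k s
      using that r by (intro mult_left_mono slope_mono cont_h h_mono w_mono) auto
    show "(\<lambda>k. s * slope (h k) s) \<longlonglongrightarrow> s * slope H s" if "s \<in> {r..1}" for s
      using that r by (intro tendsto_intros slope_lim) auto
    have "\<bar>potential (h k) r\<bar> \<le> M" for k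
      using w_range[OF r, of "Suc k"] by (simp add: wS)
    then show "bounded (range (\<lambda>k. integral {r..1} (\<lambda>s. s * slope (h k) s)))"
      unfolding potential_def by (auto simp: bounded_real intro!: exI[of _ M])
  qed
  have V_eq: "V r = potential H r" if r: "r \<in> {0..1}" for r
    using LIMSEQ_unique[OF LIMSEQ_Suc[OF w_lim[OF r]]] pot[OF r] by blast
  \<comment> \<open>A potential is an indefinite integral, so the limit is continuous although its right hand side is
    only known to be a pointwise limit. This in turn makes the right hand side continuous.\<close>
  have cV: "continuous_on {0..1} (potential H)"
    unfolding potential_def[abs_def] using pot[of 0] by (intro indefinite_integral_continuous_1') simp
  have H_eq: "H r = l * f (potential H r)" if "r \<in> {0..1}" for r
    using V_eq[OF that] by (simp add: H_def)
  have pH_range: "0 \<le> potential H r" "potential H r < 1" if "r \<in> {0..1}" for r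
    using V_range[OF that] V_eq[OF that] M(2) by auto
  have "continuous_on {0..1} (\<lambda>r. l * f (potential H r))"
    using pH_range by (intro continuous_intros continuous_on_compose2[OF f_continuous cV]) auto
  then have cH: "continuous_on {0..1} H"
    by (rule continuous_on_eq) (simp add: H_eq)
  have H_pos: "0 < H r" if "r \<in> {0..1}" for r
    using that l f_pos[of "potential H r"] pH_range[OF that] by (simp add: H_eq)
  have "radial_solution l (potential H) (slope H)"
    unfolding radial_solution_def
    using profile_cong[OF profile_potential[OF cH] H_eq] pH_range potential_pos[OF cH H_pos] by blast
  moreover have "potential H (norm x) \<le> v x" if x: "x \<in> cball 0 1" for x
  proof -
    have r: "norm x \<in> {0..1}" using x by simp
    have "\<exists>N. \<forall>k\<ge>N. w k (norm x) \<le> v x" using main x by blast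
    from LIMSEQ_le_const2[OF w_lim[OF r] this] show ?thesis using V_eq[OF r] by simp
  qed
  ultimately show ?thesis using that by blast
qed

end

section \<open>A priori bounds for decreasing radial solutions\<close>

context radial_weight
begin

text \<open>The doubling constant of the weight; \<open>bound\<close> collects the constants of the a priori
  estimates, a polynomial in it.\<close>

definition ratio :: real where "ratio = exp (2 * K) * 2 ^ (n - 1)"

definition bound :: real where "bound = 2 * ratio ^ 2 + 8 * ratio ^ 3"

lemma ratio_ge_1: "ratio \<ge> 1"
proof -
  have "1 * 1 \<le> exp (2 * K) * (2::real) ^ (n - 1)"
    using K_nonneg by (intro mult_mono) auto
  then show ?thesis by (simp add: ratio_def)
qed

lemma bound_ge: "ratio \<le> bound" "2 * ratio ^ 2 \<le> bound" "8 * ratio ^ 2 \<le> bound"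
    "ratio * (2 * ratio + 8 * ratio ^ 2) \<le> bound" "bound > 0"
proof -
  have 1: "ratio \<ge> 1" by (rule ratio_ge_1)
  have 2: "ratio \<le> ratio ^ 2" using 1 by (simp add: power2_eq_square)
  have 3: "ratio ^ 2 \<le> ratio ^ 3" using 1 by (intro power_increasing) auto
  show "ratio \<le> bound" "2 * ratio ^ 2 \<le> bound" "8 * ratio ^ 2 \<le> bound" "bound > 0"
    unfolding bound_def using 1 2 3 by linarith+
  show "ratio * (2 * ratio + 8 * ratio ^ 2) \<le> bound"
    by (simp add: bound_def power2_eq_square power3_eq_cube algebra_simps)
qed

lemma weight_doubling:
  assumes "r \<in> {0<..1}" "s \<in> {0<..1}" "r \<le> 2 * s"
  shows "weight r \<le> ratio * weight s"
proof -
  have "weight r \<le> exp K * r ^ (n - 1)" using assms by (intro weight_upper) auto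
  also have "r ^ (n - 1) \<le> (2 * s) ^ (n - 1)" using assms by (intro power_mono) auto
  also have "exp K * (2 * s) ^ (n - 1) = exp K * 2 ^ (n - 1) * exp K * (exp (- K) * s ^ (n - 1))"
    by (simp add: power_mult_distrib exp_minus)
  also have "\<dots> \<le> exp K * 2 ^ (n - 1) * exp K * weight s"
    using assms by (intro mult_left_mono weight_lower) auto
  also have "\<dots> = ratio * weight s" by (simp add: ratio_def exp_double power2_eq_square)
  finally show ?thesis by simp
qed

lemma flux_nondecreasing:
  assumes P: "profile h W m" and h: "\<And>r. r \<in> {0..1} \<Longrightarrow> 0 \<le> h r"
    and "0 \<le> s" "s \<le> r" "r \<le> 1"
  shows "weight s * (s * m s) \<le> weight r * (r * m r)"
  by (rule nondecreasing_within[of s r "{0..1}" "\<lambda>r. weight r * (r * m r)" "\<lambda>r. weight r * h r"])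
     (use assms h in \<open>auto intro!: profileD(5)[OF P] mult_nonneg_nonneg weight_nonneg\<close>)

lemma profile_slope_nonneg:
  assumes P: "profile h W m" and h: "\<And>r. r \<in> {0..1} \<Longrightarrow> 0 \<le> h r" and r: "r \<in> {0..1}"
  shows "0 \<le> m r"
proof (cases "r = 0")
  case True
  have "0 \<le> real n * m 0" using profileD(2)[OF P] h[of 0] by simp
  then show ?thesis using True n3 by (simp add: zero_le_mult_iff)
next
  case False
  have "0 \<le> weight r * (r * m r)" using flux_nondecreasing[OF P h, of 0 r] r by simp
  then show ?thesis using False r weight_pos[of r] by (simp add: zero_le_mult_iff)
qed

lemma profile_decreasing:
  assumes P: "profile h W m" and h: "\<And>r. r \<in> {0..1} \<Longrightarrow> 0 \<le> h r" and "0 \<le> s" "s \<le> r" "r \<le> 1"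
  shows "W r \<le> W s"
proof -
  have "- W s \<le> - W r"
  proof (rule nondecreasing_within[of s r "{0..1}" "\<lambda>r. - W r" "\<lambda>r. r * m r"])
    show "((\<lambda>r. - W r) has_real_derivative x * m x) (at x within {0..1})" if "x \<in> {s..r}" for x
      using DERIV_minus[OF profileD(4)[OF P, of x]] that assms by auto
  qed (use assms profile_slope_nonneg[OF P h] in auto)
  then show ?thesis by simp
qed

text \<open>For \<open>r \<le> 1/2\<close> both bounds come from the mean value theorem, on \<open>[r, 2r]\<close> for \<open>W\<close>, whose total
  variation is at most \<open>1\<close>, and on \<open>[r/2, r]\<close> for the flux. The weight is moved between comparable
  radii by the doubling property. On \<open>[1/2, 1]\<close> the monotonicity of \<open>h\<close> propagates them to the boundary.\<close>

lemma a_priori_bounds: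
  assumes P: "profile h W m" and h: "\<And>r. r \<in> {0..1} \<Longrightarrow> 0 \<le> h r"
    and h_anti: "\<And>s r. 0 \<le> s \<Longrightarrow> s \<le> r \<Longrightarrow> r \<le> 1 \<Longrightarrow> h r \<le> h s"
    and W1: "W 0 \<le> 1" and r: "r \<in> {0<..1}"
  shows "r * (r * m r) \<le> bound" "r ^ 2 * h r \<le> bound"
proof -
  have R: "ratio \<ge> 1" by (rule ratio_ge_1)
  have m0: "0 \<le> m r" if "r \<in> {0..1}" for r by (rule profile_slope_nonneg[OF P h that])
  have inner1: "r * (r * m r) \<le> ratio" if r: "0 < r" "r \<le> 1 / 2" for r
  proof -
    obtain \<xi> where \<xi>: "r < \<xi>" "\<xi> < 2 * r" "W (2 * r) - W r = (2 * r - r) * - (\<xi> * m \<xi>)"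
      using mean_value_within[of r "2 * r" "{0..1}" W "\<lambda>r. - (r * m r)"] profileD(4)[OF P] r by auto
    have "r * (\<xi> * m \<xi>) \<le> 1"
      using \<xi>(3) profile_decreasing[OF P h, of "2 * r" 1] profile_decreasing[OF P h, of 0 r]
        profileD(3)[OF P] r W1 by simp
    have "weight r * (r * m r) \<le> weight \<xi> * (\<xi> * m \<xi>)"
      using \<xi> r by (intro flux_nondecreasing[OF P h]) auto
    also have "\<dots> \<le> ratio * weight r * (\<xi> * m \<xi>)"
      using \<xi> r by (intro mult_right_mono weight_doubling mult_nonneg_nonneg m0) auto
    finally have "weight r * (r * m r) \<le> weight r * (ratio * (\<xi> * m \<xi>))" by (simp add: ac_simps)
    then have "r * m r \<le> ratio * (\<xi> * m \<xi>)"
      using weight_pos[of r] r by simp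
    then have "r * (r * m r) \<le> r * (ratio * (\<xi> * m \<xi>))"
      using r by (intro mult_left_mono) auto
    also have "\<dots> = ratio * (r * (\<xi> * m \<xi>))" by simp
    also have "\<dots> \<le> ratio * 1"
      using R \<open>r * (\<xi> * m \<xi>) \<le> 1\<close> by (intro mult_left_mono) auto
    finally show ?thesis by simp
  qed
  have inner2: "r ^ 2 * h r \<le> 2 * ratio ^ 2" if r: "0 < r" "r \<le> 1 / 2" for r
  proof -
    obtain \<xi> where \<xi>: "r / 2 < \<xi>" "\<xi> < r"
      "weight r * (r * m r) - weight (r / 2) * (r / 2 * m (r / 2)) = (r - r / 2) * (weight \<xi> * h \<xi>)"
      using mean_value_within[of "r / 2" r "{0..1}" "\<lambda>r. weight r * (r * m r)" "\<lambda>r. weight r * h r"]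
        profileD(5)[OF P] r by auto
    have "0 \<le> weight (r / 2) * (r / 2 * m (r / 2))"
      using r by (intro mult_nonneg_nonneg weight_nonneg m0) auto
    then have "r / 2 * (weight \<xi> * h \<xi>) \<le> weight r * (r * m r)" using \<xi>(3) by simp
    also have "\<dots> \<le> ratio * weight \<xi> * (r * m r)"
      using \<xi> r by (intro mult_right_mono weight_doubling mult_nonneg_nonneg m0) auto
    finally have "weight \<xi> * (r / 2 * h \<xi>) \<le> weight \<xi> * (ratio * (r * m r))" by (simp add: ac_simps)
    then have "r / 2 * h \<xi> \<le> ratio * (r * m r)" using weight_pos[of \<xi>] \<xi> r by simp
    moreover have "r / 2 * h r \<le> r / 2 * h \<xi>" using h_anti[of \<xi> r] \<xi> r by (intro mult_left_mono) auto
    ultimately have "2 * r * (r / 2 * h r) \<le> 2 * r * (ratio * (r * m r))"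
      using r by (intro mult_left_mono) auto
    also have "\<dots> = 2 * ratio * (r * (r * m r))" by simp
    also have "\<dots> \<le> 2 * ratio * ratio" using R inner1[OF r] by (intro mult_left_mono) auto
    finally show ?thesis by (simp add: power2_eq_square)
  qed
  have "r * (r * m r) \<le> bound \<and> r ^ 2 * h r \<le> bound"
  proof (cases "r \<le> 1 / 2")
    case True
    then show ?thesis using inner1[of r] inner2[of r] bound_ge r by force
  next
    case False
    have mh: "1 / 2 * m (1 / 2) \<le> 2 * ratio" using inner1[of "1 / 2"] by simp
    have hh: "h (1 / 2) \<le> 8 * ratio ^ 2" using inner2[of "1 / 2"] by (simp add: power2_eq_square)
    have hr: "h r \<le> h (1 / 2)" using h_anti[of "1 / 2" r] False r by auto
    have "r ^ 2 * h r \<le> 1 * h r"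
      using r h[of r] by (intro mult_right_mono) (auto simp: power_le_one)
    then have A: "r ^ 2 * h r \<le> bound" using hh hr bound_ge(3) by simp
    obtain \<xi> where \<xi>: "1 / 2 < \<xi>" "\<xi> < r"
      "weight r * (r * m r) - weight (1 / 2) * (1 / 2 * m (1 / 2)) = (r - 1 / 2) * (weight \<xi> * h \<xi>)"
      using mean_value_within[of "1 / 2" r "{0..1}" "\<lambda>r. weight r * (r * m r)" "\<lambda>r. weight r * h r"]
        profileD(5)[OF P] r False by auto
    have "(r - 1 / 2) * (weight \<xi> * h \<xi>) \<le> 1 * (ratio * weight r * h (1 / 2))"
      using \<xi> r False h_anti[of "1 / 2" \<xi>] R
      by (intro mult_mono weight_doubling mult_nonneg_nonneg h weight_nonneg) auto
    moreover have "weight (1 / 2) * (1 / 2 * m (1 / 2)) \<le> ratio * weight r * (1 / 2 * m (1 / 2))"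
      using r False by (intro mult_right_mono weight_doubling mult_nonneg_nonneg m0) auto
    ultimately have "weight r * (r * m r) \<le> weight r * (ratio * (1 / 2 * m (1 / 2) + h (1 / 2)))"
      using \<xi>(3) by (simp add: algebra_simps)
    then have "r * m r \<le> ratio * (1 / 2 * m (1 / 2) + h (1 / 2))"
      by (rule mult_left_le_imp_le) (use weight_pos[of r] r in auto)
    also have "\<dots> \<le> ratio * (2 * ratio + 8 * ratio ^ 2)"
      using mh hh R by (intro mult_left_mono) auto
    finally have "r * m r \<le> bound" using bound_ge(4) by linarith
    moreover have "r * (r * m r) \<le> 1 * (r * m r)"
      using r m0[of r] by (intro mult_right_mono) auto
    ultimately show ?thesis using A by simp
  qed
  then show "r * (r * m r) \<le> bound" "r ^ 2 * h r \<le> bound" by auto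
qed

lemma profile_second_deriv:
  assumes P: "profile h W m" and r: "r \<in> {0<..1}"
  shows "((\<lambda>r. r * m r) has_real_derivative h r - (real n - 1 - r * G1 r) * m r) (at r within {0..1})"
proof -
  have "((\<lambda>r. r * m r) has_real_derivative
      1 * m r + (h r - (n - r * G1 r) * m r) / r * r) (at r within {0..1})"
    by (intro DERIV_mult DERIV_ident profile_slope_deriv[OF P r])
  moreover have "1 * m r + (h r - (n - r * G1 r) * m r) / r * r = h r - (real n - 1 - r * G1 r) * m r"
  proof -
    have "(h r - (n - r * G1 r) * m r) / r * r = h r - (n - r * G1 r) * m r" using r by simp
    then show ?thesis by (simp add: algebra_simps)
  qed
  ultimately show ?thesis by simp
qed

lemma second_deriv_bound:
  assumes P: "profile h W m" and h: "\<And>r. r \<in> {0..1} \<Longrightarrow> 0 \<le> h r"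
    and h_anti: "\<And>s r. 0 \<le> s \<Longrightarrow> s \<le> r \<Longrightarrow> r \<le> 1 \<Longrightarrow> h r \<le> h s"
    and W1: "W 0 \<le> 1" and r: "r \<in> {0<..1}"
  shows "\<bar>h r - (real n - 1 - r * G1 r) * m r\<bar> \<le> (1 + n + K) * bound / r ^ 2"
proof -
  note b = a_priori_bounds[OF P h h_anti W1 r]
  have r0: "r > 0" "r \<le> 1" "r \<in> {0..1}" using r by auto
  have m0: "0 \<le> m r" by (rule profile_slope_nonneg[OF P h r0(3)])
  have "\<bar>r * G1 r\<bar> \<le> 1 * K"
    unfolding abs_mult using r0 G1_bound[of r] by (intro mult_mono) auto
  then have "\<bar>real n - 1 - r * G1 r\<bar> \<le> n + K" using n3 by linarith
  then have "\<bar>(real n - 1 - r * G1 r) * m r\<bar> \<le> (n + K) * m r"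
    unfolding abs_mult using m0 by (intro mult_mono) auto
  then have "\<bar>h r - (real n - 1 - r * G1 r) * m r\<bar> \<le> h r + (n + K) * m r"
    using h[OF r0(3)] by linarith
  also have "\<dots> \<le> bound / r ^ 2 + (n + K) * (bound / r ^ 2)"
    using b r0 K_nonneg
    by (intro add_mono mult_left_mono) (auto simp: field_simps power2_eq_square)
  also have "\<dots> = (1 + n + K) * bound / r ^ 2" using r0 by (simp add: field_simps)
  finally show ?thesis .
qed

end

section \<open>Picone's identity and the decay of semistable solutions\<close>

context radial_weight
begin

text \<open>Up to the radius \<open>rho\<close> the potential \<open>(n-1)/r\<^sup>2\<close> dominates the perturbation \<open>G''\<close>. The exponent
  \<open>hardy\<close> is the borderline one: \<open>\<zeta> = r\<^sup>-\<^sup>\<beta>\<close> with \<open>\<beta>\<^sup>2 = n - 1\<close> satisfies \<open>\<zeta>'\<^sup>2 = (n-1)/r\<^sup>2 \<zeta>\<^sup>2\<close>.\<close>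

definition rho :: real where "rho = 1 / (2 * (1 + K))"

definition hardy :: real where "hardy = sqrt (real n - 1)"

definition outer_const :: real where
  "outer_const = (bound / rho)\<^sup>2 * (2 * exp K) + (bound / rho) * (exp K * ((1 + n + K) * bound / rho\<^sup>2))"

definition stable_const :: real where
  "stable_const = sqrt (8 * ratio * 2 powr (2 * hardy) * rho powr (- 2 * hardy) * exp (2 * rho) * outer_const * exp K)"

lemma rho: "0 < rho" "rho \<le> 1 / 2" "K * (rho * rho) \<le> 1 / 2" "1 + K \<le> 2 * (1 / rho)"
proof -
  show "0 < rho" "rho \<le> 1 / 2" using K_nonneg by (auto simp: rho_def field_simps)
  have "K * rho \<le> 1" using K_nonneg by (simp add: rho_def field_simps)
  then have "K * rho * rho \<le> 1 * rho" using \<open>0 < rho\<close> by (intro mult_right_mono) auto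
  then show "K * (rho * rho) \<le> 1 / 2" using \<open>rho \<le> 1 / 2\<close> by (simp add: mult.assoc)
  show "1 + K \<le> 2 * (1 / rho)" using K_nonneg by (simp add: rho_def)
qed

lemma hardy: "1 \<le> hardy" "hardy\<^sup>2 = real n - 1"
  using n3 by (auto simp: hardy_def)

lemma outer_const_nonneg: "0 \<le> outer_const"
  unfolding outer_const_def using bound_ge(5) rho(1) K_nonneg by (intro add_nonneg_nonneg mult_nonneg_nonneg) auto

lemma stable_const_nonneg: "0 \<le> stable_const"
  and stable_const_sq: "stable_const\<^sup>2 =
     8 * ratio * 2 powr (2 * hardy) * rho powr (- 2 * hardy) * exp (2 * rho) * outer_const * exp K"
  using outer_const_nonneg ratio_ge_1 by (simp_all add: stable_const_def)

end

text \<open>Abstractly: \<open>y\<close> with right hand side \<open>h\<close> lies below \<open>V\<close> with the larger right hand side \<open>k\<close>. Here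
  \<open>d\<close> stands for \<open>\<lambda> f'(y)\<close>, so the last two assumptions are the chain rule and the tangent inequality of
  the convex function \<open>f\<close>.\<close>

locale semistable_profile = radial_weight n G G1 G2 K
  for n :: nat and G G1 G2 :: "real \<Rightarrow> real" and K :: real +
  fixes h y m k V M d :: "real \<Rightarrow> real"
  assumes lower: "profile h y m" and upper: "profile k V M"
    and h_nonneg: "\<And>r. r \<in> {0..1} \<Longrightarrow> 0 \<le> h r"
    and h_less: "\<And>r. r \<in> {0..1} \<Longrightarrow> h r < k r"
    and h_anti: "\<And>s r. 0 \<le> s \<Longrightarrow> s \<le> r \<Longrightarrow> r \<le> 1 \<Longrightarrow> h r \<le> h s"
    and y_le_1: "y 0 \<le> 1"
    and h_deriv: "\<And>r. r \<in> {0<..<1} \<Longrightarrow> (h has_real_derivative - (d r * (r * m r))) (at r)"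
    and supersol: "\<And>r. r \<in> {0<..<1} \<Longrightarrow> d r * (V r - y r) \<le> k r - h r"
begin

text \<open>In the notation of the introduction, with \<open>\<psi> = V - y\<close> and \<open>w = r m = -y'\<close>: \<open>gap\<close> is \<open>\<psi>\<close>,
  \<open>gap_flux\<close> is \<open>- p \<psi>'\<close>, \<open>accel\<close> is \<open>w'\<close>, \<open>picone\<close> is \<open>Q = p w\<^sup>2 (\<psi>'/\<psi> - w'/w)\<close> and
  \<open>picone_defect\<close> is \<open>w \<psi>'/\<psi> - w'\<close>. The division by \<open>w\<close> is multiplied out since \<open>w\<close> may
  vanish.\<close>

definition gap :: "real \<Rightarrow> real" where "gap r = V r - y r"
definition gap_flux :: "real \<Rightarrow> real" where "gap_flux r = weight r * (r * (M r - m r))"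
definition accel :: "real \<Rightarrow> real" where "accel r = h r - (real n - 1 - r * G1 r) * m r"
definition picone :: "real \<Rightarrow> real" where
  "picone r = - ((r * m r)\<^sup>2 * gap_flux r / gap r) - (r * m r) * (weight r * accel r)"
definition picone_defect :: "real \<Rightarrow> real" where
  "picone_defect r = - ((r * m r) * gap_flux r / (weight r * gap r)) - accel r"

lemma m_nonneg: "r \<in> {0..1} \<Longrightarrow> 0 \<le> m r"
  by (rule profile_slope_nonneg[OF lower h_nonneg])

lemma gap_flux_deriv:
  "r \<in> {0..1} \<Longrightarrow> (gap_flux has_real_derivative weight r * (k r - h r)) (at r within {0..1})"
proof -
  assume r: "r \<in> {0..1}"
  have "gap_flux = (\<lambda>r. weight r * (r * M r) - weight r * (r * m r))"
    by (auto simp: gap_flux_def algebra_simps)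
  then show ?thesis
    using DERIV_diff[OF profileD(5)[OF upper r] profileD(5)[OF lower r]] by (simp add: algebra_simps)
qed

lemma gap_deriv:
  "r \<in> {0..1} \<Longrightarrow> (gap has_real_derivative - (r * (M r - m r))) (at r within {0..1})"
proof -
  assume r: "r \<in> {0..1}"
  have "gap = (\<lambda>r. V r - y r)" by (auto simp: gap_def)
  then show ?thesis
    using DERIV_diff[OF profileD(4)[OF upper r] profileD(4)[OF lower r]] by (simp add: algebra_simps)
qed

lemma gap_flux_mono:
  assumes "0 \<le> s" "s \<le> r" "r \<le> 1"
  shows "gap_flux s \<le> gap_flux r"
proof (rule nondecreasing_within[of s r "{0..1}" gap_flux "\<lambda>r. weight r * (k r - h r)"])
  show "0 \<le> weight x * (k x - h x)" if "s < x" "x < r" for x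
    using h_less[of x] weight_nonneg[of x] that assms by simp
qed (use assms gap_flux_deriv in auto)

lemma gap_flux_pos:
  assumes "0 < r" "r \<le> 1"
  shows "0 < gap_flux r"
proof -
  obtain \<xi> where \<xi>: "0 < \<xi>" "\<xi> < r" "gap_flux r - gap_flux 0 = (r - 0) * (weight \<xi> * (k \<xi> - h \<xi>))"
    using mean_value_within[of 0 r "{0..1}" gap_flux "\<lambda>r. weight r * (k r - h r)"] gap_flux_deriv assms
    by auto
  have "0 < (r - 0) * (weight \<xi> * (k \<xi> - h \<xi>))"
    using \<xi> assms h_less[of \<xi>] weight_pos[of \<xi>] by simp
  moreover have "gap_flux 0 = 0" by (simp add: gap_flux_def)
  ultimately show ?thesis using \<xi>(3) by simp
qed

text \<open>The flux of \<open>\<psi>\<close> grows outwards, so \<open>\<psi>\<close> falls to its boundary value \<open>0\<close> at a rate comparable to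
  that at \<open>r\<close> or faster. This both makes \<open>\<psi>\<close> positive and bounds \<open>- \<psi>'/\<psi>\<close> from above.\<close>

lemma gap_ge:
  assumes "0 < r" "r < 1"
  shows "(1 - r) * gap_flux r / exp K \<le> gap r"
proof -
  obtain \<xi> where \<xi>: "r < \<xi>" "\<xi> < 1" "gap 1 - gap r = (1 - r) * - (\<xi> * (M \<xi> - m \<xi>))"
    using mean_value_within[of r 1 "{0..1}" gap "\<lambda>r. - (r * (M r - m r))"] gap_deriv assms by auto
  have w\<xi>: "0 < weight \<xi>" using \<xi> assms by (intro weight_pos) auto
  have "weight \<xi> \<le> exp K * \<xi> ^ (n - 1)" using \<xi> assms by (intro weight_upper) auto
  also have "\<dots> \<le> exp K * 1" using \<xi> assms by (intro mult_left_mono power_le_one) auto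
  finally have w_le: "weight \<xi> \<le> exp K" by simp
  have "gap_flux r / exp K \<le> gap_flux \<xi> / weight \<xi>"
    using gap_flux_mono[of r \<xi>] gap_flux_pos[of \<xi>] \<xi> assms w_le w\<xi> by (intro frac_le) auto
  also have "\<dots> = \<xi> * (M \<xi> - m \<xi>)" using w\<xi> by (simp add: gap_flux_def)
  finally have "(1 - r) * (gap_flux r / exp K) \<le> (1 - r) * (\<xi> * (M \<xi> - m \<xi>))"
    using assms by (intro mult_left_mono) auto
  also have "\<dots> = gap r"
    using \<xi>(3) profileD(3)[OF upper] profileD(3)[OF lower] by (simp add: gap_def)
  finally show ?thesis by simp
qed

lemma gap_pos:
  assumes "0 < r" "r < 1"
  shows "0 < gap r"
proof -
  have "0 < (1 - r) * gap_flux r / exp K" using gap_flux_pos[of r] assms by simp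
  then show ?thesis using gap_ge[OF assms] by linarith
qed

lemma picone_eq: "0 < r \<Longrightarrow> picone r = weight r * ((r * m r) * picone_defect r)"
  using weight_pos[of r] by (simp add: picone_def picone_defect_def power2_eq_square algebra_simps)

text \<open>The linearised equation for \<open>w\<close>, with the extra potential \<open>(n-1)/r\<^sup>2 + G''\<close>. It is obtained by
  differentiating \<open>p w' = p h - ((n-1)/r - G') p w\<close>, where the flux \<open>p w\<close> has derivative \<open>p h\<close>.\<close>

lemma weight_accel_deriv:
  assumes r: "r \<in> {0<..<1}"
  shows "((\<lambda>r. weight r * accel r) has_real_derivative
     weight r * (((real n - 1) / r\<^sup>2 + G2 r) - d r) * (r * m r)) (at r)"
proof -
  have at: "at r within {0..1} = at r" using r by (simp add: at_within_Icc_at)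
  define A where "A = (\<lambda>r. (real n - 1) / r - G1 r)"
  have r': "r \<in> {0<..1}" "r \<in> {0..1}" "r \<noteq> 0" using r by auto
  have dA: "(A has_real_derivative - ((real n - 1) / r\<^sup>2) - G2 r) (at r)"
    unfolding A_def using r' G1_deriv[OF r'(2)] at
    by (auto intro!: derivative_eq_intros simp: power2_eq_square minus_divide_left)
  have dw: "(weight has_real_derivative weight r * A r) (at r)"
    using weight_deriv[OF r'(1)] at by (simp add: A_def)
  have dF: "((\<lambda>r. weight r * (r * m r)) has_real_derivative weight r * h r) (at r)"
    using profileD(5)[OF lower r'(2)] at by simp
  have "((\<lambda>r. weight r * h r - A r * (weight r * (r * m r))) has_real_derivative
     (weight r * A r * h r + - (d r * (r * m r)) * weight r) -
     ((- ((real n - 1) / r\<^sup>2) - G2 r) * (weight r * (r * m r)) + weight r * h r * A r)) (at r)"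
    by (intro DERIV_diff DERIV_mult dw h_deriv[OF r] dA dF)
  moreover have "(weight r * A r * h r + - (d r * (r * m r)) * weight r) -
     ((- ((real n - 1) / r\<^sup>2) - G2 r) * (weight r * (r * m r)) + weight r * h r * A r) =
     weight r * (((real n - 1) / r\<^sup>2 + G2 r) - d r) * (r * m r)"
    by (simp add: algebra_simps)
  ultimately have D: "((\<lambda>r. weight r * h r - A r * (weight r * (r * m r))) has_real_derivative
     weight r * (((real n - 1) / r\<^sup>2 + G2 r) - d r) * (r * m r)) (at r)" by simp
  show ?thesis
  proof (rule has_field_derivative_transform_within_open[OF D, of "{0<..}"])
    show "weight s * h s - A s * (weight s * (s * m s)) = weight s * accel s" if "s \<in> {0<..}" for s
      using that by (simp add: A_def accel_def field_simps)
  qed (use r in auto)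
qed

text \<open>Picone's inequality. The reaction terms \<open>d\<close> of the two equations cancel, up to the sign given by the
  supersolution property of \<open>\<psi>\<close>.\<close>

lemma picone_deriv:
  assumes r: "r \<in> {0<..<1}"
  shows "(picone has_real_derivative deriv picone r) (at r)"
    and "deriv picone r \<le> - weight r * ((picone_defect r)\<^sup>2 + ((real n - 1) / r\<^sup>2 + G2 r) * (r * m r)\<^sup>2)"
proof -
  have at: "at r within {0..1} = at r" using r by (simp add: at_within_Icc_at)
  have r': "r \<in> {0<..1}" "r \<in> {0..1}" "0 < r" "r < 1" using r by auto
  define w p \<psi> S B where "w = r * m r" and "p = weight r" and "\<psi> = gap r" and "S = gap_flux r"
    and "B = (real n - 1) / r\<^sup>2 + G2 r"
  have p: "p > 0" using weight_pos r' by (simp add: p_def)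
  have \<psi>: "\<psi> > 0" using gap_pos r' by (simp add: \<psi>_def)
  have dw: "((\<lambda>r. r * m r) has_real_derivative accel r) (at r)"
    using profile_second_deriv[OF lower r'(1)] at by (simp add: accel_def)
  have dw2: "((\<lambda>r. (r * m r)\<^sup>2) has_real_derivative 2 * w * accel r) (at r)"
    using DERIV_power[OF dw, of 2] by (simp add: w_def ac_simps)
  have dS: "(gap_flux has_real_derivative p * (k r - h r)) (at r)"
    using gap_flux_deriv[OF r'(2)] at by (simp add: p_def)
  have d\<psi>: "(gap has_real_derivative - (S / p)) (at r)"
    using gap_deriv[OF r'(2)] at p by (simp add: S_def p_def gap_flux_def)
  have dJ: "((\<lambda>r. weight r * accel r) has_real_derivative p * (B - d r) * w) (at r)"
    using weight_accel_deriv[OF r] by (simp add: p_def w_def B_def)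
  define Q' where "Q' = - (((2 * w * accel r * S + p * (k r - h r) * w\<^sup>2) * \<psi> - w\<^sup>2 * S * (- (S / p))) / (\<psi> * \<psi>))
      - (accel r * (p * accel r) + p * (B - d r) * w * w)"
  have dQ: "(picone has_real_derivative Q') (at r)"
    unfolding picone_def[abs_def] Q'_def w_def p_def \<psi>_def S_def
    using \<psi> by (intro DERIV_diff DERIV_minus DERIV_mult DERIV_divide dw dw2[unfolded w_def] dS[unfolded p_def]
        d\<psi>[unfolded S_def p_def] dJ[unfolded w_def p_def]) (auto simp: \<psi>_def)
  have picone_defect: "picone_defect r = - (w * S / (p * \<psi>)) - accel r" by (simp add: picone_defect_def w_def p_def S_def \<psi>_def)
  have split: "Q' = - p * ((picone_defect r)\<^sup>2 + B * w\<^sup>2) - p * w\<^sup>2 * ((k r - h r) / \<psi> - d r)"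
    unfolding Q'_def picone_defect using p \<psi> by (simp add: field_simps power2_eq_square)
  have "d r \<le> (k r - h r) / \<psi>"
    using supersol[OF r] \<psi> by (simp add: field_simps \<psi>_def gap_def)
  then have "0 \<le> p * w\<^sup>2 * ((k r - h r) / \<psi> - d r)" using p by simp
  then have "Q' \<le> - p * ((picone_defect r)\<^sup>2 + B * w\<^sup>2)" using split by linarith
  moreover have "deriv picone r = Q'" by (rule DERIV_imp_deriv[OF dQ])
  ultimately show "(picone has_real_derivative deriv picone r) (at r)"
    and "deriv picone r \<le> - weight r * ((picone_defect r)\<^sup>2 + ((real n - 1) / r\<^sup>2 + G2 r) * (r * m r)\<^sup>2)"
    using dQ by (simp_all add: p_def B_def w_def)
qed

text \<open>The choice \<open>\<zeta> = r\<close>: completing the square leaves \<open>p w\<^sup>2 (1 - (n-1) - r\<^sup>2 G'')\<close>, which is negative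
  for \<open>n \<ge> 3\<close> and \<open>r \<le> rho\<close>.\<close>

lemma sq_picone_deriv:
  assumes r: "r \<in> {0<..rho}"
  shows "((\<lambda>r. r\<^sup>2 * picone r) has_real_derivative 2 * r * picone r + r\<^sup>2 * deriv picone r) (at r)"
    and "2 * r * picone r + r\<^sup>2 * deriv picone r \<le> - (weight r * (r * m r)\<^sup>2 / 2)"
proof -
  have r': "r \<in> {0<..<1}" "0 < r" "r \<le> 1" "r \<le> rho" using r rho by auto
  note dQ = picone_deriv[OF r'(1)]
  have "((\<lambda>r. r\<^sup>2 * picone r) has_real_derivative 2 * r * picone r + deriv picone r * r\<^sup>2) (at r)"
    by (rule DERIV_mult[OF _ dQ(1)]) (auto intro!: derivative_eq_intros)
  then show "((\<lambda>r. r\<^sup>2 * picone r) has_real_derivative 2 * r * picone r + r\<^sup>2 * deriv picone r) (at r)"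
    by (simp add: mult.commute)
  define w p where "w = r * m r" and "p = weight r"
  have p: "p \<ge> 0" using weight_nonneg r' by (simp add: p_def)
  have "K * (r * r) \<le> K * (rho * rho)" using r' K_nonneg by (intro mult_left_mono mult_mono) auto
  then have "K * r\<^sup>2 \<le> 1 / 2" using rho(3) by (simp add: power2_eq_square)
  moreover have "- (r\<^sup>2 * G2 r) \<le> r\<^sup>2 * K"
    using mult_left_mono[of "- G2 r" K "r\<^sup>2"] G2_bound[of r] r' by auto
  ultimately have c: "1 - (real n - 1) - r\<^sup>2 * G2 r \<le> - 1 / 2"
    using n3 by (simp add: mult.commute)
  have "2 * r * picone r + r\<^sup>2 * deriv picone r \<le>
      2 * r * (p * (w * picone_defect r)) + r\<^sup>2 * (- p * ((picone_defect r)\<^sup>2 + ((real n - 1) / r\<^sup>2 + G2 r) * w\<^sup>2))"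
    using dQ(2) picone_eq[OF r'(2)] by (intro add_mono mult_left_mono) (use r' in \<open>auto simp: p_def w_def\<close>)
  also have "\<dots> = - (p * (r * picone_defect r - w)\<^sup>2) + p * w\<^sup>2 * (1 - (real n - 1) - r\<^sup>2 * G2 r)"
    using r' by (simp add: field_simps power2_eq_square)
  also have "\<dots> \<le> 0 + p * w\<^sup>2 * (- 1 / 2)"
    using c p by (intro add_mono mult_left_mono) auto
  finally show "2 * r * picone r + r\<^sup>2 * deriv picone r \<le> - (weight r * (r * m r)\<^sup>2 / 2)"
    by (simp add: p_def w_def)
qed

lemma sq_picone_step:
  assumes "0 < a" "a < b" "b \<le> rho"
  obtains \<xi> where "a < \<xi>" "\<xi> < b" "b\<^sup>2 * picone b - a\<^sup>2 * picone a \<le> (b - a) * - (weight \<xi> * (\<xi> * m \<xi>)\<^sup>2 / 2)"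
proof -
  obtain \<xi> where \<xi>: "a < \<xi>" "\<xi> < b"
    "b\<^sup>2 * picone b - a\<^sup>2 * picone a = (b - a) * (2 * \<xi> * picone \<xi> + \<xi>\<^sup>2 * deriv picone \<xi>)"
    using mean_value_within[of a b UNIV "\<lambda>r. r\<^sup>2 * picone r" "\<lambda>r. 2 * r * picone r + r\<^sup>2 * deriv picone r"]
      sq_picone_deriv(1) assms by auto
  moreover have "(b - a) * (2 * \<xi> * picone \<xi> + \<xi>\<^sup>2 * deriv picone \<xi>) \<le> (b - a) * - (weight \<xi> * (\<xi> * m \<xi>)\<^sup>2 / 2)"
    using \<xi> assms by (intro mult_left_mono sq_picone_deriv(2)) auto
  ultimately show ?thesis using that by auto
qed

text \<open>\<open>r\<^sup>2 Q\<close> is nonincreasing, so it suffices that its upper limit at \<open>0\<close> is not positive. There \<open>\<psi>'\<close>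
  only contributes a negative term, and the term with \<open>w'\<close> is small because \<open>w = r m\<close> with bounded \<open>m\<close>.\<close>

lemma picone_nonpos:
  assumes r: "0 < r" "r \<le> rho"
  shows "picone r \<le> 0"
proof (rule ccontr)
  assume "\<not> picone r \<le> 0"
  then have \<eta>: "r\<^sup>2 * picone r > 0" using r by simp
  obtain x1 where x1: "x1 \<in> {0..1}" "\<And>x. x \<in> {0..1} \<Longrightarrow> m x \<le> m x1"
    using continuous_attains_sup[of "{0..1}" m] profileD(1)[OF lower] by auto
  define B where "B = m x1"
  have B: "B \<ge> 0" "\<And>x. x \<in> {0..1} \<Longrightarrow> m x \<le> B"
    using x1 m_nonneg[of x1] by (auto simp: B_def)
  define c where "c = exp K * (n + K) * B\<^sup>2"
  have c: "c \<ge> 0" using K_nonneg by (simp add: c_def)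
  have small: "s\<^sup>2 * picone s \<le> c * s" if s: "0 < s" "s \<le> rho" for s
  proof -
    have s': "s \<in> {0..1}" "s \<in> {0<..<1}" "s \<le> 1" using s rho by auto
    have "\<bar>s * G1 s\<bar> \<le> 1 * K"
      unfolding abs_mult using s' s G1_bound[of s] by (intro mult_mono) auto
    then have "(real n - 1 - s * G1 s) * m s \<le> (n + K) * B"
      using B(2)[OF s'(1)] m_nonneg[OF s'(1)] K_nonneg n3 by (intro mult_mono) auto
    then have acc: "- accel s \<le> (n + K) * B" using h_nonneg[OF s'(1)] by (simp add: accel_def)
    have "0 \<le> (s * m s)\<^sup>2 * gap_flux s / gap s"
      using gap_pos[of s] gap_flux_pos[of s] s s' by auto
    then have "picone s \<le> (s * m s) * weight s * - accel s" by (simp add: picone_def)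
    also have "\<dots> \<le> (s * m s) * weight s * ((n + K) * B)"
      using acc m_nonneg[OF s'(1)] s weight_nonneg[of s] by (intro mult_left_mono) auto
    also have "\<dots> \<le> (s * B) * (exp K * 1) * ((n + K) * B)"
    proof (intro mult_mono)
      have "weight s \<le> exp K * s ^ (n - 1)" by (rule weight_upper[OF s'(1)])
      also have "\<dots> \<le> exp K * 1" using s s' by (intro mult_left_mono power_le_one) auto
      finally show "weight s \<le> exp K * 1" .
    qed (use B s s' m_nonneg[OF s'(1)] weight_nonneg[of s] K_nonneg in auto)
    also have "\<dots> = c * s" by (simp add: c_def power2_eq_square)
    finally have "picone s \<le> c * s" .
    then have "s\<^sup>2 * picone s \<le> s\<^sup>2 * (c * s)" by (intro mult_left_mono) auto
    also have "\<dots> \<le> 1 * (c * s)" using s s' c by (intro mult_right_mono) (auto simp: power_le_one)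
    finally show ?thesis by simp
  qed
  define s where "s = min (r / 2) (r\<^sup>2 * picone r / (2 * (c + 1)))"
  have s: "0 < s" "s < r" "s \<le> r\<^sup>2 * picone r / (2 * (c + 1))"
    using \<eta> r c by (auto simp: s_def)
  obtain \<xi> where \<xi>: "s < \<xi>" "\<xi> < r" "r\<^sup>2 * picone r - s\<^sup>2 * picone s \<le> (r - s) * - (weight \<xi> * (\<xi> * m \<xi>)\<^sup>2 / 2)"
    using sq_picone_step[OF s(1,2) r(2)] by blast
  have "0 \<le> (r - s) * (weight \<xi> * (\<xi> * m \<xi>)\<^sup>2 / 2)"
    using \<xi> s weight_nonneg[of \<xi>] by auto
  then have "r\<^sup>2 * picone r \<le> s\<^sup>2 * picone s" using \<xi>(3) by simp
  also have "\<dots> \<le> c * s" using small[of s] s r by simp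
  also have "\<dots> \<le> (c + 1) * (r\<^sup>2 * picone r / (2 * (c + 1)))"
    using s c by (intro mult_mono) auto
  also have "\<dots> = r\<^sup>2 * picone r / 2" using c by (simp add: field_simps)
  finally show False using \<eta> by simp
qed

text \<open>Between \<open>s\<close> and \<open>2s\<close> the function \<open>r\<^sup>2 Q\<close> drops by a multiple of \<open>s p w\<^sup>2\<close> at some intermediate
  point, and monotonicity of the flux carries this back to \<open>s\<close>.\<close>

lemma picone_quantitative:
  assumes s: "0 < s" "2 * s \<le> rho"
  shows "picone (2 * s) \<le> - (weight s * (s * m s)\<^sup>2 / (8 * ratio * s))"
proof -
  obtain \<xi> where \<xi>: "s < \<xi>" "\<xi> < 2 * s"
    "(2 * s)\<^sup>2 * picone (2 * s) - s\<^sup>2 * picone s \<le> (2 * s - s) * - (weight \<xi> * (\<xi> * m \<xi>)\<^sup>2 / 2)"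
    using sq_picone_step[of s "2 * s"] s by auto
  have pos: "0 < weight \<xi>" "0 < weight s" "\<xi> \<le> 1" using \<xi> s weight_pos rho by auto
  have "s\<^sup>2 * picone s \<le> 0" using picone_nonpos[of s] s by (intro mult_nonneg_nonpos) auto
  have "(weight s * (s * m s))\<^sup>2 \<le> (weight \<xi> * (\<xi> * m \<xi>))\<^sup>2"
    using \<xi> s pos m_nonneg[of s] by (intro power_mono flux_nondecreasing[OF lower h_nonneg]) auto
  also have "\<dots> = weight \<xi> * (weight \<xi> * (\<xi> * m \<xi>)\<^sup>2)" by (simp add: power2_eq_square)
  also have "\<dots> \<le> (ratio * weight s) * (weight \<xi> * (\<xi> * m \<xi>)\<^sup>2)"
    using \<xi> s pos rho by (intro mult_right_mono weight_doubling) auto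
  finally have "weight s * (weight s * (s * m s)\<^sup>2) \<le> weight s * (ratio * (weight \<xi> * (\<xi> * m \<xi>)\<^sup>2))"
    by (simp add: power2_eq_square ac_simps)
  then have "weight s * (s * m s)\<^sup>2 \<le> ratio * (weight \<xi> * (\<xi> * m \<xi>)\<^sup>2)"
    by (rule mult_left_le_imp_le) (rule pos)
  then have *: "weight s * (s * m s)\<^sup>2 / ratio \<le> weight \<xi> * (\<xi> * m \<xi>)\<^sup>2"
    using ratio_ge_1 by (simp add: field_simps)
  have "4 * s * (s * picone (2 * s)) \<le> s * - (weight \<xi> * (\<xi> * m \<xi>)\<^sup>2 / 2)"
    using \<xi>(3) \<open>s\<^sup>2 * picone s \<le> 0\<close> by (simp add: power2_eq_square)
  also have "\<dots> \<le> s * - (weight s * (s * m s)\<^sup>2 / ratio / 2)"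
    using * s by (intro mult_left_mono) auto
  finally have "s * (4 * s * picone (2 * s)) \<le> s * - (weight s * (s * m s)\<^sup>2 / ratio / 2)" by (simp add: ac_simps)
  then have "4 * s * picone (2 * s) \<le> - (weight s * (s * m s)\<^sup>2 / ratio / 2)"
    by (rule mult_left_le_imp_le) (rule s)
  then show ?thesis using s ratio_ge_1 by (simp add: field_simps)
qed

text \<open>The choice \<open>\<zeta> = r\<^sup>-\<^sup>\<beta> e\<^sup>r\<close>: completing the square leaves \<open>(1 - \<beta>/r)\<^sup>2 - (n-1)/r\<^sup>2 - G''\<close>. The
  leading terms cancel, and \<open>1 - 2\<beta>/r - G'' \<le> 0\<close> up to \<open>rho\<close>.\<close>

lemma weighted_picone_decreasing:
  assumes "0 < a" "a \<le> rho"
  shows "rho powr (- 2 * hardy) * exp (2 * rho) * picone rho \<le> a powr (- 2 * hardy) * exp (2 * a) * picone a"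
proof -
  define Z where "Z r = r powr (- 2 * hardy) * exp (2 * r)" for r :: real
  have dZ: "(Z has_real_derivative Z r * (2 - 2 * hardy / r)) (at r)" if "r > 0" for r
    unfolding Z_def using that
    by (auto intro!: derivative_eq_intros simp: powr_diff field_simps)
  have "- (Z a * picone a) \<le> - (Z rho * picone rho)"
  proof (rule nondecreasing_within[of a rho UNIV "\<lambda>r. - (Z r * picone r)"
        "\<lambda>r. - (Z r * (2 - 2 * hardy / r) * picone r + deriv picone r * Z r)"])
    show "((\<lambda>r. - (Z r * picone r)) has_real_derivative
        - (Z r * (2 - 2 * hardy / r) * picone r + deriv picone r * Z r)) (at r)" if "r \<in> {a..rho}" for r
      using that assms rho by (intro DERIV_minus DERIV_mult dZ picone_deriv) auto
    show "0 \<le> - (Z r * (2 - 2 * hardy / r) * picone r + deriv picone r * Z r)" if "a < r" "r < rho" for r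
    proof -
      have r: "0 < r" "r < 1" "r \<in> {0<..<1}" "r < rho" using that assms rho by auto
      define w p where "w = r * m r" and "p = weight r"
      have p: "p \<ge> 0" using weight_nonneg r by (simp add: p_def)
      have Z: "Z r \<ge> 0" by (simp add: Z_def)
      have "1 + K \<le> 2 * (1 / r)"
      proof -
        have "1 / rho \<le> 1 / r" using r by (intro divide_left_mono) auto
        then show ?thesis using rho(4) by simp
      qed
      also have "\<dots> \<le> 2 * (hardy / r)"
        using r hardy(1) by (intro mult_left_mono divide_right_mono) auto
      finally have "(1 - hardy / r)\<^sup>2 - (real n - 1) / r\<^sup>2 - G2 r \<le> 0"
        using G2_bound[of r] r hardy(2) by (simp add: power2_diff power_divide)
      then have c: "p * w\<^sup>2 * ((1 - hardy / r)\<^sup>2 - (real n - 1) / r\<^sup>2 - G2 r) \<le> 0"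
        using p by (intro mult_nonneg_nonpos) auto
      have "(2 - 2 * hardy / r) * picone r + deriv picone r \<le>
         2 * (1 - hardy / r) * (p * (w * picone_defect r)) + - p * ((picone_defect r)\<^sup>2 + ((real n - 1) / r\<^sup>2 + G2 r) * w\<^sup>2)"
        using picone_eq[OF r(1)] picone_deriv(2)[OF r(3)] by (simp add: w_def p_def)
      also have "\<dots> = - (p * (picone_defect r - (1 - hardy / r) * w)\<^sup>2)
          + p * w\<^sup>2 * ((1 - hardy / r)\<^sup>2 - (real n - 1) / r\<^sup>2 - G2 r)"
      proof -
        have "2 * a * (p * (w * picone_defect r)) + - p * ((picone_defect r)\<^sup>2 + (N + G2 r) * w\<^sup>2) =
            - (p * (picone_defect r - a * w)\<^sup>2) + p * w\<^sup>2 * (a\<^sup>2 - N - G2 r)" for a N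
          by (simp add: power2_eq_square algebra_simps)
        then show ?thesis .
      qed
      also have "\<dots> \<le> 0"
      proof -
        have "0 \<le> p * (picone_defect r - (1 - hardy / r) * w)\<^sup>2" using p by simp
        then show ?thesis using c by linarith
      qed
      finally have "Z r * ((2 - 2 * hardy / r) * picone r + deriv picone r) \<le> 0"
        using Z by (intro mult_nonneg_nonpos)
      then show ?thesis by (simp add: algebra_simps)
    qed
  qed (use assms in auto)
  then show ?thesis by (simp add: Z_def)
qed

lemma picone_lower: "- picone rho \<le> outer_const"
proof -
  have r: "rho \<in> {0<..1}" "rho \<in> {0..1}" "0 < rho" "rho < 1" "rho \<le> 1 / 2" using rho by auto
  note b = a_priori_bounds(1)[OF lower h_nonneg h_anti y_le_1 r(1)]
    second_deriv_bound[OF lower h_nonneg h_anti y_le_1 r(1)]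
  have w: "0 \<le> rho * m rho" "rho * m rho \<le> bound / rho"
    using b(1) r m_nonneg[OF r(2)] by (auto simp: field_simps)
  have wt: "weight rho \<le> exp K"
  proof -
    have "weight rho \<le> exp K * rho ^ (n - 1)" by (rule weight_upper[OF r(2)])
    also have "\<dots> \<le> exp K * 1" using r by (intro mult_left_mono power_le_one) auto
    finally show ?thesis by simp
  qed
  have gp: "0 < gap rho" "0 < gap_flux rho" using gap_pos gap_flux_pos r by auto
  have "1 / 2 * gap_flux rho / exp K \<le> (1 - rho) * gap_flux rho / exp K"
    using r gp by (intro divide_right_mono mult_right_mono) auto
  also have "\<dots> \<le> gap rho" using gap_ge[OF r(3,4)] .
  finally have "gap_flux rho / gap rho \<le> 2 * exp K" using gp by (simp add: field_simps)
  then have "(rho * m rho)\<^sup>2 * (gap_flux rho / gap rho) \<le> (bound / rho)\<^sup>2 * (2 * exp K)"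
    using w gp by (intro mult_mono power_mono) auto
  moreover have "(rho * m rho) * (weight rho * accel rho) \<le>
      (bound / rho) * (exp K * ((1 + n + K) * bound / rho\<^sup>2))"
  proof -
    have "weight rho * accel rho \<le> weight rho * \<bar>accel rho\<bar>"
      using weight_nonneg[of rho] r by (intro mult_left_mono) auto
    also have "\<dots> \<le> exp K * ((1 + n + K) * bound / rho\<^sup>2)"
      using wt b(2) weight_nonneg[of rho] r by (intro mult_mono) (auto simp: accel_def)
    finally have "(rho * m rho) * (weight rho * accel rho) \<le> (rho * m rho) * (exp K * ((1 + n + K) * bound / rho\<^sup>2))"
      using w by (intro mult_left_mono) auto
    also have "\<dots> \<le> (bound / rho) * (exp K * ((1 + n + K) * bound / rho\<^sup>2))"
      using w bound_ge(5) K_nonneg r by (intro mult_right_mono) auto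
    finally show ?thesis .
  qed
  ultimately show ?thesis by (simp add: picone_def outer_const_def)
qed

text \<open>Chain the lower bound on \<open>- Q(2s)\<close> by \<open>p(s) w(s)\<^sup>2 / s\<close> with the monotonicity up to \<open>rho\<close> and
  the bound there, then solve for \<open>w(s)\<close> using \<open>p(s) \<ge> e\<^sup>-\<^sup>K s\<^sup>n\<^sup>-\<^sup>1\<close>.\<close>

lemma stable_estimate:
  assumes s: "0 < s" "2 * s \<le> rho"
  shows "s * m s \<le> stable_const * s powr (- n / 2 + 1 + hardy)"
proof -
  have s1: "s \<in> {0..1}" "s \<le> 1" using s rho by auto
  define w where "w = s * m s"
  have w0: "w \<ge> 0" using s m_nonneg[OF s1(1)] by (simp add: w_def)
  define E where "E = weight s * w\<^sup>2 / (8 * ratio * s)"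
  have E0: "E \<ge> 0" using weight_nonneg[of s] ratio_ge_1 s by (simp add: E_def)
  define Zr where "Zr = rho powr (- 2 * hardy) * exp (2 * rho)"
  have Zr0: "Zr \<ge> 0" by (simp add: Zr_def)
  have QE: "picone (2 * s) \<le> - E" using picone_quantitative[OF s] by (simp add: E_def w_def)
  have "(2 * s) powr (- 2 * hardy) * E \<le> (2 * s) powr (- 2 * hardy) * exp (2 * (2 * s)) * E"
    using E0 s by (intro mult_right_mono) auto
  also have "\<dots> \<le> (2 * s) powr (- 2 * hardy) * exp (2 * (2 * s)) * - picone (2 * s)"
    using QE by (intro mult_left_mono) auto
  also have "\<dots> \<le> Zr * - picone rho"
    using weighted_picone_decreasing[of "2 * s"] s by (simp add: Zr_def)
  also have "\<dots> \<le> Zr * outer_const" using picone_lower Zr0 by (intro mult_left_mono) auto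
  finally have 1: "(2 * s) powr (- 2 * hardy) * E \<le> Zr * outer_const" .
  have "E = (2 * s) powr (2 * hardy) * ((2 * s) powr (- 2 * hardy) * E)"
    using s by (simp add: powr_add[symmetric] mult.assoc[symmetric])
  also have "\<dots> \<le> (2 * s) powr (2 * hardy) * (Zr * outer_const)"
    using 1 by (intro mult_left_mono) auto
  finally have 2: "weight s * w\<^sup>2 \<le> 8 * ratio * s * ((2 * s) powr (2 * hardy) * (Zr * outer_const))"
    using s ratio_ge_1 by (simp add: E_def field_simps)
  have pw: "s ^ (n - 1) = s powr (real n - 1)"
    using s n3 by (simp add: powr_realpow[symmetric] of_nat_diff)
  have "exp (- K) * s powr (real n - 1) * w\<^sup>2 \<le> weight s * w\<^sup>2"
    using weight_lower[OF s1(1), unfolded pw] by (intro mult_right_mono) auto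
  with 2 have "exp (- K) * s powr (real n - 1) * w\<^sup>2 \<le> 8 * ratio * s * ((2 * s) powr (2 * hardy) * (Zr * outer_const))"
    by linarith
  then have "exp K * s powr (1 - real n) * (exp (- K) * s powr (real n - 1) * w\<^sup>2)
     \<le> exp K * s powr (1 - real n) * (8 * ratio * s * ((2 * s) powr (2 * hardy) * (Zr * outer_const)))"
    by (intro mult_left_mono) auto
  moreover have "exp K * s powr (1 - real n) * (exp (- K) * s powr (real n - 1) * w\<^sup>2) = w\<^sup>2"
  proof -
    have "exp K * s powr (1 - real n) * (exp (- K) * s powr (real n - 1) * w\<^sup>2)
       = (exp K * exp (- K)) * (s powr (1 - real n) * s powr (real n - 1)) * w\<^sup>2" by simp
    also have "\<dots> = w\<^sup>2" using s by (simp add: exp_minus powr_add[symmetric] del: mult_exp_exp)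
    finally show ?thesis .
  qed
  moreover have "exp K * s powr (1 - real n) * (8 * ratio * s * ((2 * s) powr (2 * hardy) * (Zr * outer_const)))
     = stable_const\<^sup>2 * (s powr (- n / 2 + 1 + hardy))\<^sup>2"
  proof -
    have "(s powr (- n / 2 + 1 + hardy))\<^sup>2 = s powr ((1 - real n) + 1 + 2 * hardy)"
      using s by (simp add: power2_eq_square powr_add[symmetric] algebra_simps)
    also have "\<dots> = s powr (1 - real n) * s * s powr (2 * hardy)"
      unfolding powr_add using s by simp
    finally show ?thesis using s
      by (simp add: stable_const_sq Zr_def powr_mult ac_simps)
  qed
  ultimately have "w\<^sup>2 \<le> (stable_const * s powr (- n / 2 + 1 + hardy))\<^sup>2"
    by (simp add: power_mult_distrib)
  then have "w \<le> stable_const * s powr (- n / 2 + 1 + hardy)"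
    by (rule power2_le_imp_le) (simp add: stable_const_nonneg)
  then show ?thesis by (simp add: w_def)
qed

end

section \<open>Minimal and extremal solutions\<close>

text \<open>Otherwise \<open>l\<close> would be an upper bound of the parameters with a regular solution, a set that contains
  \<open>l\<close> itself.\<close>

lemma larger_parameter_below_lambda_star:
  assumes "0 < l" "l < lambda_star c f" "regular_solution c f l u"
  obtains l' v where "l < l'" "regular_solution c f l' v"
proof (rule ccontr)
  assume "\<not> thesis"
  then have "\<And>l'. l' \<in> {l. 0 < l \<and> (\<exists>u. regular_solution c f l u)} \<Longrightarrow> l' \<le> l"
    using that by force
  then have "lambda_star c f \<le> l"
    unfolding lambda_star_def using assms by (intro cSup_least) auto
  then show False using assms by simp
qed

locale convex_radial_problem = radial_problem G G1 G2 K \<gamma> f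
  for G G1 G2 :: "real \<Rightarrow> real" and K :: real and \<gamma> :: "'a::euclidean_space \<Rightarrow> real" and f :: "real \<Rightarrow> real" +
  fixes f' :: "real \<Rightarrow> real"
  assumes f_deriv: "\<And>t. t \<in> {0<..<1} \<Longrightarrow> (f has_real_derivative f' t) (at t)"
    and f_convex: "convex_on {0..<1} f"
begin

lemma f_tangent:
  assumes "a \<in> {0<..<1}" "b \<in> {0..<1}"
  shows "f' a * (b - a) \<le> f b - f a"
  by (rule convex_on_imp_above_tangent[OF f_convex])
     (use assms f_deriv[of a] in \<open>auto simp: has_field_derivative_at_within\<close>)

lemma regular_solution_01:
  assumes "regular_solution c f l u" "x \<in> cball 0 1"
  shows "0 \<le> u x \<and> u x < 1"
proof (cases "x \<in> ball 0 1")
  case False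
  then have "u x = 0" using assms by (auto simp: regular_solution_def)
  then show ?thesis by simp
qed (use assms in \<open>auto simp: regular_solution_def less_imp_le\<close>)

lemma radial_solution_below_regular:
  assumes "0 < l" "l \<le> l'" "regular_solution (grad \<gamma>) f l' v"
  obtains W m where "radial_solution l W m" "\<And>x. x \<in> cball 0 1 \<Longrightarrow> W (norm x) \<le> v x"
proof (rule radial_solution_below[OF assms(1)])
  show "Ck_on 2 (cball 0 1) v" using assms(3) by (simp add: regular_solution_def)
  show "\<And>x. x \<in> cball 0 1 \<Longrightarrow> 0 \<le> v x \<and> v x < 1" by (rule regular_solution_01[OF assms(3)])
  fix x :: 'a assume x: "x \<in> ball 0 1"
  have "l * f (v x) \<le> l' * f (v x)"
    using regular_solution_01[OF assms(3), of x] x assms(2) f_pos[of "v x"] by (intro mult_right_mono) auto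
  also have "\<dots> = - laplacian v x + grad \<gamma> x \<bullet> grad v x"
    using assms(3) x by (simp add: regular_solution_def)
  finally show "l * f (v x) \<le> - laplacian v x + grad \<gamma> x \<bullet> grad v x" .
qed (use that in blast)

text \<open>The iteration below \<open>u\<close> produces a radial regular solution, which minimality forces to be \<open>u\<close>.\<close>

lemma minimal_solution_radial:
  assumes l: "0 < l" and u: "minimal_solution (grad \<gamma>) f l u"
  obtains W m where "radial_solution l W m" "\<And>x. x \<in> cball 0 1 \<Longrightarrow> u x = W (norm x)"
proof -
  have reg: "regular_solution (grad \<gamma>) f l u" using u by (simp add: minimal_solution_def)
  obtain W m where W: "radial_solution l W m" "\<And>x. x \<in> cball 0 1 \<Longrightarrow> W (norm x) \<le> u x"
    using radial_solution_below_regular[OF l order_refl reg] by blast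
  note regW = regular_solution_radial[OF W(1)]
  have "u x = W (norm x)" if x: "x \<in> cball 0 1" for x
  proof (cases "x \<in> ball 0 1")
    case True
    then have "u x \<le> W (norm x)" using u regW by (auto simp: minimal_solution_def)
    then show ?thesis using W(2)[OF x] by simp
  next
    case False
    then have "x \<in> sphere 0 1" using x by auto
    then show ?thesis
      using reg profileD(3)[OF radial_solutionD(1)[OF W(1)]] by (simp add: regular_solution_def)
  qed
  then show ?thesis using that W(1) by blast
qed

lemma radial_solution_decreasing:
  assumes R: "radial_solution l W m" and l: "0 < l"
  shows "r \<in> {0..1} \<Longrightarrow> 0 \<le> l * f (W r)"
    and "0 \<le> s \<Longrightarrow> s \<le> r \<Longrightarrow> r \<le> 1 \<Longrightarrow> l * f (W r) \<le> l * f (W s)"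
    and "W 0 \<le> 1"
proof -
  note D = radial_solutionD[OF R]
  show nonneg: "0 \<le> l * f (W r)" if "r \<in> {0..1}" for r
    using l f_pos[of "W r"] D(2,3)[OF that] by simp
  show "l * f (W r) \<le> l * f (W s)" if "0 \<le> s" "s \<le> r" "r \<le> 1"
    using profile_decreasing[OF D(1) nonneg that] D(2,3)[of s] D(2,3)[of r] that l
    by (intro mult_left_mono mono_onD[OF f_mono]) auto
  show "W 0 \<le> 1" using D(3)[of 0] by simp
qed

definition exponent :: real where
  "exponent = - real DIM('a) / 2 + 1 + sqrt (real DIM('a) - 1)"

text \<open>The summands serve the region near the origin, the bound \<open>C/r\<close>, and the region \<open>2 r \<ge> rho\<close>,
  where \<open>r\<close> is bounded below and the sign of the exponent does not matter.\<close>

definition gradient_const :: real where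
  "gradient_const = stable_const + bound + 2 * bound / rho * (rho / 2) powr (- \<bar>exponent\<bar>)"

lemma gradient_const_pos: "0 < gradient_const"
  unfolding gradient_const_def using stable_const_nonneg bound_ge(5) rho(1)
  by (intro add_nonneg_pos add_pos_nonneg) auto

text \<open>How minimality gives semistability: a radial solution \<open>V\<close> for a larger parameter is a
  supersolution for \<open>l\<close>, so some radial solution for \<open>l\<close>, and hence \<open>u\<close>, lies below \<open>V\<close>.\<close>

lemma minimal_solution_stable_estimate:
  assumes l: "0 < l" "l < lambda_star (grad \<gamma>) f" and u: "minimal_solution (grad \<gamma>) f l u"
    and W: "radial_solution l W m" "\<And>x. x \<in> cball 0 1 \<Longrightarrow> u x = W (norm x)"
    and s: "0 < s" "2 * s \<le> rho"
  shows "s * m s \<le> stable_const * s powr exponent"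
proof -
  have reg: "regular_solution (grad \<gamma>) f l u" using u by (simp add: minimal_solution_def)
  obtain l' v where l': "l < l'" "regular_solution (grad \<gamma>) f l' v"
    using larger_parameter_below_lambda_star[OF l reg] by blast
  then have l'0: "0 < l'" using l by simp
  obtain V M where V: "radial_solution l' V M"
    using radial_solution_below_regular[OF l'0 order_refl l'(2)] by blast
  obtain W2 m2 where W2: "radial_solution l W2 m2" "\<And>x::'a. x \<in> cball 0 1 \<Longrightarrow> W2 (norm x) \<le> V (norm x)"
    using radial_solution_below_regular[OF l(1) less_imp_le[OF l'(1)] regular_solution_radial[OF V]] by blast
  obtain e :: 'a where e: "e \<in> Basis" using nonempty_Basis by blast
  note DW = radial_solutionD[OF W(1)] and DV = radial_solutionD[OF V]
  have le: "W r \<le> V r" if r: "r \<in> {0..1}" for r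
  proof (cases "r = 1")
    case True
    then show ?thesis using profileD(3)[OF DW(1)] profileD(3)[OF DV(1)] by simp
  next
    case False
    then have x: "r *\<^sub>R e \<in> ball 0 1" "norm (r *\<^sub>R e) = r" "r *\<^sub>R e \<in> cball 0 1" using r e by auto
    have "u (r *\<^sub>R e) \<le> W2 (norm (r *\<^sub>R e))"
      using u regular_solution_radial[OF W2(1)] x(1) unfolding minimal_solution_def by blast
    then show ?thesis using W(2)[OF x(3)] W2(2)[OF x(3)] x(2) by simp
  qed
  have f_le: "f (W r) \<le> f (V r)" if "r \<in> {0..1}" for r
    using le[OF that] DW(2,3)[OF that] DV(2,3)[OF that] by (intro mono_onD[OF f_mono]) auto
  interpret S: semistable_profile "DIM('a)" G G1 G2 K "\<lambda>r. l * f (W r)" W m "\<lambda>r. l' * f (V r)" V M "\<lambda>r. l * f' (W r)"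
  proof
    show "profile (\<lambda>r. l * f (W r)) W m" "profile (\<lambda>r. l' * f (V r)) V M" by (rule DW(1), rule DV(1))
    show "\<And>r. r \<in> {0..1} \<Longrightarrow> 0 \<le> l * f (W r)"
      "\<And>s r. 0 \<le> s \<Longrightarrow> s \<le> r \<Longrightarrow> r \<le> 1 \<Longrightarrow> l * f (W r) \<le> l * f (W s)" "W 0 \<le> 1"
      using radial_solution_decreasing[OF W(1) l(1)] by auto
    show "l * f (W r) < l' * f (V r)" if r: "r \<in> {0..1}" for r
    proof -
      have "l * f (W r) \<le> l * f (V r)" using f_le[OF r] l by simp
      also have "\<dots> < l' * f (V r)" using l'(1) f_pos[of "V r"] DV(2,3)[OF r] by simp
      finally show ?thesis .
    qed
    fix r :: real assume r: "r \<in> {0<..<1}"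
    have W01: "W r \<in> {0<..<1}" "W r \<in> {0..<1}" "V r \<in> {0..<1}"
      using DW(3,4)[of r] DV(2,3)[of r] r by auto
    have "(W has_real_derivative - (r * m r)) (at r)"
      using profileD(4)[OF DW(1), of r] r by (simp add: at_within_Icc_at)
    from DERIV_cmult[OF DERIV_chain2[OF f_deriv[OF W01(1)] this], of l]
    show "((\<lambda>r. l * f (W r)) has_real_derivative - (l * f' (W r) * (r * m r))) (at r)"
      by (simp add: mult.assoc)
    have "l * f' (W r) * (V r - W r) \<le> l * (f (V r) - f (W r))"
      using f_tangent[OF W01(1,3)] l by (simp add: mult.assoc)
    also have "\<dots> \<le> l' * f (V r) - l * f (W r)"
      using l'(1) f_pos[OF W01(3)] by (simp add: algebra_simps)
    finally show "l * f' (W r) * (V r - W r) \<le> l' * f (V r) - l * f (W r)" .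
  qed
  show ?thesis using S.stable_estimate[OF s] by (simp add: exponent_def hardy_def)
qed

lemma minimal_solution_gradient_bound:
  assumes l: "0 < l" "l < lambda_star (grad \<gamma>) f" and u: "minimal_solution (grad \<gamma>) f l u"
    and W: "radial_solution l W m" "\<And>x. x \<in> cball 0 1 \<Longrightarrow> u x = W (norm x)"
    and r: "r \<in> {0<..1}"
  shows "r * m r \<le> gradient_const * r powr (-1)" "r * m r \<le> gradient_const * r powr exponent"
proof -
  have r': "0 < r" "r \<le> 1" using r by auto
  note DW = radial_solutionD[OF W(1)]
  have b: "r * (r * m r) \<le> bound"
    by (rule a_priori_bounds(1)[OF DW(1) radial_solution_decreasing[OF W(1) l(1)] r])
  then have b1: "r * m r \<le> bound / r" using r' by (simp add: field_simps)
  have "bound \<le> gradient_const"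
    unfolding gradient_const_def using stable_const_nonneg bound_ge(5) rho(1) by auto
  then have "bound / r \<le> gradient_const / r" using r' by (intro divide_right_mono) auto
  then show "r * m r \<le> gradient_const * r powr (-1)"
    using b1 r' by (simp add: powr_minus field_simps)
  show "r * m r \<le> gradient_const * r powr exponent"
  proof (cases "2 * r \<le> rho")
    case True
    have "r * m r \<le> stable_const * r powr exponent"
      by (rule minimal_solution_stable_estimate[OF l u W r'(1) True])
    also have "\<dots> \<le> gradient_const * r powr exponent"
      unfolding gradient_const_def using bound_ge(5) rho(1) by (intro mult_right_mono) auto
    finally show ?thesis .
  next
    case False
    then have far: "rho / 2 \<le> r" by simp
    have "(rho / 2) powr \<bar>exponent\<bar> \<le> r powr \<bar>exponent\<bar>" using far rho(1) by (intro powr_mono2) auto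
    also have "\<dots> \<le> r powr exponent" using r' by (intro powr_mono') auto
    finally have "(rho / 2) powr (- \<bar>exponent\<bar>) * (rho / 2) powr \<bar>exponent\<bar>
        \<le> (rho / 2) powr (- \<bar>exponent\<bar>) * r powr exponent"
      by (intro mult_left_mono) auto
    then have 1: "1 \<le> (rho / 2) powr (- \<bar>exponent\<bar>) * r powr exponent"
      using rho(1) by (simp add: powr_add[symmetric])
    have "bound / r \<le> 2 * bound / rho"
      using far rho(1) r' bound_ge(5) by (simp add: field_simps)
    also have "\<dots> \<le> 2 * bound / rho * ((rho / 2) powr (- \<bar>exponent\<bar>) * r powr exponent)"
      using mult_left_mono[OF 1, of "2 * bound / rho"] bound_ge(5) rho(1) by simp
    also have "\<dots> = (2 * bound / rho * (rho / 2) powr (- \<bar>exponent\<bar>)) * r powr exponent" by simp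
    also have "\<dots> \<le> gradient_const * r powr exponent"
      unfolding gradient_const_def using bound_ge(5) stable_const_nonneg by (intro mult_right_mono) auto
    finally show ?thesis using b1 by linarith
  qed
qed

definition decay :: "real \<Rightarrow> real" where
  "decay r = (if DIM('a) \<ge> 10 then gradient_const * r powr (-1) else gradient_const * r powr exponent)"

lemma minimal_solution_profile:
  assumes l: "0 < l" "l < lambda_star (grad \<gamma>) f" and u: "minimal_solution (grad \<gamma>) f l u"
  obtains W m where "radial_solution l W m" "\<And>x. x \<in> cball 0 1 \<Longrightarrow> u x = W (norm x)"
    "\<And>r. r \<in> {0<..1} \<Longrightarrow> \<bar>- (r * m r)\<bar> \<le> decay r"
proof -
  obtain W m where W: "radial_solution l W m" "\<And>x. x \<in> cball 0 1 \<Longrightarrow> u x = W (norm x)"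
    using minimal_solution_radial[OF l(1) u] by blast
  have "\<bar>- (r * m r)\<bar> \<le> decay r" if r: "r \<in> {0<..1}" for r
  proof -
    have "0 \<le> r * m r"
      using r profile_slope_nonneg[OF radial_solutionD(1)[OF W(1)] radial_solution_decreasing(1)[OF W(1) l(1)], of r]
      by simp
    then show ?thesis using minimal_solution_gradient_bound[OF l u W r] by (simp add: decay_def)
  qed
  with W that show ?thesis by blast
qed

text \<open>Along a sequence of parameters increasing to the extremal one, the profiles have a common bound on the
  first derivative at \<open>r\<close> and on the second derivative on \<open>[r/2, 1]\<close>.\<close>

lemma extremal_solution_gradient_bound:
  assumes u: "extremal_solution (grad \<gamma>) f u" and L: "0 < lambda_star (grad \<gamma>) f"
  shows "\<exists>T. (\<forall>x\<in>cball 0 1. u x = T (norm x)) \<and>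
     (\<forall>r\<in>{0<..1}. \<exists>D. (T has_real_derivative D) (at r within {0..1}) \<and> \<bar>D\<bar> \<le> decay r)"
proof -
  define L where "L = lambda_star (grad \<gamma>) f"
  have L0: "L > 0" using L by (simp add: L_def)
  obtain U where U: "\<And>l. l \<in> {0<..<L} \<Longrightarrow> minimal_solution (grad \<gamma>) f l (U l)"
    and U_lim: "\<And>x. x \<in> cball 0 1 \<Longrightarrow> ((\<lambda>l. U l x) \<longlongrightarrow> u x) (at_left L)"
    using u unfolding extremal_solution_def L_def by blast
  define lk where "lk k = L - L * inverse (real (Suc (Suc k)))" for k
  have lk: "0 < lk k" "lk k < L" for k
  proof -
    have "0 < inverse (real (Suc (Suc k)))" "inverse (real (Suc (Suc k))) < 1"
      by (simp_all add: inverse_eq_divide)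
    then have "0 < L * inverse (real (Suc (Suc k)))" "L * inverse (real (Suc (Suc k))) < L * 1"
      using L0 by (intro mult_pos_pos mult_strict_left_mono; simp)+
    then show "0 < lk k" "lk k < L" by (simp_all add: lk_def)
  qed
  have "(\<lambda>k. inverse (real (Suc (Suc k)))) \<longlonglongrightarrow> 0"
    by (rule LIMSEQ_Suc[OF LIMSEQ_inverse_real_of_nat])
  then have "lk \<longlonglongrightarrow> L - L * 0" unfolding lk_def by (intro tendsto_intros)
  then have lk_lim: "filterlim lk (at_left L) sequentially"
    using lk by (auto simp: filterlim_at intro!: always_eventually)
  have "\<forall>k. \<exists>W m. radial_solution (lk k) W m \<and> (\<forall>x\<in>cball 0 1. U (lk k) x = W (norm x)) \<and>
      (\<forall>r\<in>{0<..1}. \<bar>- (r * m r)\<bar> \<le> decay r)"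
  proof
    fix k
    have "minimal_solution (grad \<gamma>) f (lk k) (U (lk k))" using U lk by auto
    from minimal_solution_profile[OF lk(1) lk(2)[unfolded L_def] this]
    show "\<exists>W m. radial_solution (lk k) W m \<and> (\<forall>x\<in>cball 0 1. U (lk k) x = W (norm x)) \<and>
      (\<forall>r\<in>{0<..1}. \<bar>- (r * m r)\<bar> \<le> decay r)" by metis
  qed
  then obtain W m where R: "\<And>k. radial_solution (lk k) (W k) (m k)"
    and UW: "\<And>k x. x \<in> cball 0 1 \<Longrightarrow> U (lk k) x = W k (norm x)"
    and dec: "\<And>k r. r \<in> {0<..1} \<Longrightarrow> \<bar>- (r * m k r)\<bar> \<le> decay r"
    by metis
  note P = radial_solutionD(1)[OF R] and Rd = radial_solution_decreasing[OF R lk(1)]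
  have W_lim: "(\<lambda>k. W k (norm x)) \<longlonglongrightarrow> u x" if x: "x \<in> cball 0 1" for x
    using filterlim_compose[OF U_lim[OF x] lk_lim] UW[OF x] by simp
  obtain e :: 'a where e: "e \<in> Basis" using nonempty_Basis by blast
  define T where "T r = u (r *\<^sub>R e)" for r
  have T_lim: "(\<lambda>k. W k r) \<longlonglongrightarrow> T r" if "r \<in> {0..1}" for r
    using W_lim[of "r *\<^sub>R e"] that e by (simp add: T_def)
  have "u x = T (norm x)" if x: "x \<in> cball 0 1" for x
    by (rule LIMSEQ_unique[OF W_lim[OF x] T_lim]) (use x in simp)
  moreover have "\<exists>D. (T has_real_derivative D) (at r within {0..1}) \<and> \<bar>D\<bar> \<le> decay r" if r: "r \<in> {0<..1}" for r
  proof -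
    have r': "0 < r" "r \<le> 1" using r by auto
    define B where "B = (1 + DIM('a) + K) * bound / (r / 2) ^ 2"
    have "\<exists>D. \<bar>D\<bar> \<le> decay r \<and> (T has_real_derivative D) (at r within {r / 2..1})"
    proof (rule derivative_of_limit[where Y = W and Y' = "\<lambda>k s. - (s * m k s)" and B = B])
      show "r \<in> {r / 2..1}" using r' by simp
      show "(W k has_real_derivative - (s * m k s)) (at s within {r / 2..1})" if "s \<in> {r / 2..1}" for k s
        using DERIV_subset[OF profileD(4)[OF P, of s k], of "{r / 2..1}"] that r' by auto
      show "\<bar>- (r * m k r)\<bar> \<le> decay r" for k by (rule dec[OF r])
      show "(\<lambda>k. W k s) \<longlonglongrightarrow> T s" if "s \<in> {r / 2..1}" for s
        using that r' by (intro T_lim) auto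
      have lip: "\<bar>b * m k b - a * m k a\<bar> \<le> B * (b - a)" if ab: "r / 2 \<le> a" "a < b" "b \<le> 1" for a b k
      proof -
        let ?A = "\<lambda>s. lk k * f (W k s) - (real DIM('a) - 1 - s * G1 s) * m k s"
        have in01: "s \<in> {0<..1}" if "s \<in> {a..b}" for s using that ab r' by auto
        obtain \<xi> where \<xi>: "a < \<xi>" "\<xi> < b" "b * m k b - a * m k a = (b - a) * ?A \<xi>"
          using mean_value_within[of a b "{0..1}" "\<lambda>s. s * m k s" ?A] profile_second_deriv[OF P in01] ab r'
          by auto
        have \<xi>1: "\<xi> \<in> {0<..1}" using \<xi> by (intro in01) auto
        have "\<bar>?A \<xi>\<bar> \<le> (1 + DIM('a) + K) * bound / \<xi> ^ 2"
          by (rule second_deriv_bound[OF P Rd \<xi>1])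
        also have "\<dots> \<le> B"
          unfolding B_def using \<xi> ab r' K_nonneg bound_ge(5) by (intro divide_left_mono power_mono) auto
        finally have "(b - a) * \<bar>?A \<xi>\<bar> \<le> (b - a) * B" using ab by (intro mult_left_mono) auto
        then show ?thesis unfolding \<xi>(3) using ab by (simp add: abs_mult mult.commute)
      qed
      show "\<bar>- (s * m k s) - - (r * m k r)\<bar> \<le> B * \<bar>s - r\<bar>" if s: "s \<in> {r / 2..1}" for k s
      proof (cases s r rule: linorder_cases)
        case less
        then show ?thesis using lip[of s r k] s r' by auto
      next
        case greater
        then show ?thesis using lip[of r s k] s r' by (auto simp: abs_minus_commute)
      qed simp
    qed
    then obtain D where D: "\<bar>D\<bar> \<le> decay r" "(T has_real_derivative D) (at r within {r / 2..1})" by blast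
    have "at r within {r / 2..1} = at r within {0..1}"
      by (rule at_within_nhd[of r "{r / 2<..}"]) (use r' in auto)
    then show ?thesis using D by auto
  qed
  ultimately show ?thesis by blast
qed

end

text \<open>The radial part is \<open>\<gamma>\<close> restricted to a coordinate ray; its derivatives are the pure partial
  derivatives of \<open>\<gamma>\<close> there, and they are bounded by compactness.\<close>

lemma radial_drift_exists:
  fixes \<gamma> :: "'a::euclidean_space \<Rightarrow> real"
  assumes dim: "DIM('a) \<ge> 3" and \<gamma>: "Ck_on 2 (cball 0 1) \<gamma>" and rad: "radial_on (cball 0 1) \<gamma>"
  shows "\<exists>G G1 G2 K. radial_drift G G1 G2 K \<gamma>"
proof -
  obtain g1 g2 where d1: "\<And>x. x \<in> cball 0 1 \<Longrightarrow>
      (\<gamma> has_derivative (\<lambda>h. \<Sum>i\<in>Basis. (h \<bullet> i) * g1 i x)) (at x within cball 0 1)"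
    and d2: "\<And>i x. i \<in> Basis \<Longrightarrow> x \<in> cball 0 1 \<Longrightarrow>
       (g1 i has_derivative (\<lambda>h. \<Sum>j\<in>Basis. (h \<bullet> j) * g2 i j x)) (at x within cball 0 1)"
    and c2: "\<And>i j. i \<in> Basis \<Longrightarrow> j \<in> Basis \<Longrightarrow> continuous_on (cball 0 1) (g2 i j)"
    using Ck_on_2D[OF \<gamma>] by blast
  obtain e :: 'a where e: "e \<in> Basis" using nonempty_Basis by blast
  have ray: "(\<lambda>r. r *\<^sub>R e) ` {0..1} \<subseteq> cball 0 1" using e by auto
  have along_ray: "((\<lambda>r. g (r *\<^sub>R e)) has_real_derivative g' e) (at r within {0..1})"
    if r: "r \<in> {0..1}"
      and g: "(g has_derivative (\<lambda>h. \<Sum>i\<in>Basis. (h \<bullet> i) * g' i)) (at (r *\<^sub>R e) within cball 0 1)"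
    for g :: "'a \<Rightarrow> real" and g' r
  proof -
    have "((\<lambda>r. r *\<^sub>R e) has_derivative (\<lambda>s. s *\<^sub>R e)) (at r within {0..1})"
      by (auto intro!: derivative_eq_intros)
    from has_derivative_in_compose[OF this has_derivative_subset[OF g ray]]
    have "((\<lambda>r. g (r *\<^sub>R e)) has_derivative (\<lambda>s. \<Sum>i\<in>Basis. (s *\<^sub>R e \<bullet> i) * g' i)) (at r within {0..1})" .
    moreover have "(\<Sum>i\<in>Basis. (s *\<^sub>R e \<bullet> i) * g' i) = g' e * s" for s
      using sum_Basis_component[OF e, of g'] by (simp add: mult.assoc sum_distrib_left[symmetric])
    ultimately show ?thesis by (simp add: has_field_derivative_def)
  qed
  define G G1 G2 where "G r = \<gamma> (r *\<^sub>R e)" and "G1 r = g1 e (r *\<^sub>R e)" and "G2 r = g2 e e (r *\<^sub>R e)" for r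
  have in_ball: "r *\<^sub>R e \<in> cball 0 1" if "r \<in> {0..1}" for r using that ray by blast
  have dG: "(G has_real_derivative G1 r) (at r within {0..1})" if "r \<in> {0..1}" for r
    unfolding G_def[abs_def] G1_def by (rule along_ray[OF that d1[OF in_ball[OF that]]])
  have dG1: "(G1 has_real_derivative G2 r) (at r within {0..1})" if "r \<in> {0..1}" for r
    unfolding G1_def[abs_def] G2_def by (rule along_ray[OF that d2[OF e in_ball[OF that]]])
  have "continuous_on {0..1} G2"
    unfolding G2_def by (rule continuous_on_compose2[OF c2[OF e e] _ ray]) (intro continuous_intros)
  moreover have "continuous_on {0..1} G" "continuous_on {0..1} G1"
    using dG dG1 DERIV_continuous_on by blast+
  moreover have "\<exists>B. \<forall>r\<in>{0..1}. \<bar>g r\<bar> \<le> B" if "continuous_on {0..1} g" for g :: "real \<Rightarrow> real"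
    using compact_imp_bounded[OF compact_continuous_image[OF that compact_Icc]]
    by (auto simp: bounded_real)
  ultimately obtain B0 B1 B2 where B: "\<forall>r\<in>{0..1}. \<bar>G r\<bar> \<le> B0" "\<forall>r\<in>{0..1}. \<bar>G1 r\<bar> \<le> B1"
    "\<forall>r\<in>{0..1}. \<bar>G2 r\<bar> \<le> B2" by meson
  have "radial_drift G G1 G2 (max B0 (max B1 B2)) \<gamma>"
  proof
    show "DIM('a) \<ge> 3" by (rule dim)
    show "\<gamma> x = G (norm x)" if x: "x \<in> cball 0 1" for x
    proof -
      have "norm x *\<^sub>R e \<in> cball 0 1" "norm (norm x *\<^sub>R e) = norm x" using x e by auto
      then show ?thesis using rad x unfolding radial_on_def G_def by metis
    qed
    show "\<gamma> differentiable (at x)" if "x \<in> ball 0 1" for x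
      by (rule Ck_on_2_differentiable(1)[OF \<gamma> that])
  qed (use dG dG1 B in \<open>auto simp: le_max_iff_disj\<close>)
  then show ?thesis by blast
qed

lemma Ck_on_2_real_deriv:
  assumes "Ck_on 2 {a..<b} f"
  shows "\<exists>f'. \<forall>t\<in>{a<..<b}. (f has_real_derivative f' t) (at t)"
proof -
  obtain f' where f': "\<forall>t\<in>{a..<b}. (f has_derivative (\<lambda>h. \<Sum>i\<in>Basis. (h \<bullet> i) * f' i t)) (at t within {a..<b})"
    using Ck_on_2D[OF assms] by blast
  have "(f has_real_derivative f' 1 t) (at t)" if t: "t \<in> {a<..<b}" for t
  proof -
    have "at t within {a..<b} = at t" using t by (intro at_within_interior) auto
    moreover have "(f has_derivative (\<lambda>h. \<Sum>i\<in>Basis. (h \<bullet> i) * f' i t)) (at t within {a..<b})"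
      using f' t by auto
    ultimately show ?thesis by (simp add: has_field_derivative_def mult_commute_abs)
  qed
  then show ?thesis by blast
qed

theorem theorem2:
  fixes \<gamma> :: "real ^ 'n \<Rightarrow> real" and f :: "real \<Rightarrow> real"
  assumes "CARD('n) \<ge> 3"
    and "smooth_on (cball 0 1) \<gamma>" and "radial_on (cball 0 1) \<gamma>"
    and "Ck_on 2 {0..<1} f" and "\<forall>t\<in>{0..<1}. f t > 0"
    and "mono_on {0..<1} f" and "convex_on {0..<1} f"
    and "filterlim f at_top (at_left 1)"
  shows "\<exists>C>0. \<forall>l\<in>{0<..lambda_star (grad \<gamma>) f}. \<forall>u.
    (if l < lambda_star (grad \<gamma>) f then minimal_solution (grad \<gamma>) f l u
     else extremal_solution (grad \<gamma>) f u) \<longrightarrow>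
    (\<exists>U. (\<forall>x\<in>cball 0 1. u x = U (norm x)) \<and>
       (\<forall>r\<in>{0<..1}. \<exists>D. (U has_real_derivative D) (at r within {0..1}) \<and>
          \<bar>D\<bar> \<le> (if CARD('n) \<ge> 10 then C * r powr (-1)
                 else C * r powr (- real CARD('n) / 2 + 1 + sqrt (real CARD('n) - 1)))))"
proof -
  obtain G G1 G2 K where drift: "radial_drift G G1 G2 K \<gamma>"
    using radial_drift_exists[of \<gamma>] assms(1-3) unfolding smooth_on_def by auto
  obtain f' where f': "\<forall>t\<in>{0<..<1}. (f has_real_derivative f' t) (at t)"
    using Ck_on_2_real_deriv[OF assms(4)] by blast
  interpret radial_drift G G1 G2 K \<gamma> by (rule drift)
  interpret convex_radial_problem G G1 G2 K \<gamma> f f'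
    by unfold_locales (use assms Ck_on_2_continuous[OF assms(4)] f' in auto)
  have decay_eq: "decay r = (if CARD('n) \<ge> 10 then gradient_const * r powr (-1)
      else gradient_const * r powr (- real CARD('n) / 2 + 1 + sqrt (real CARD('n) - 1)))" for r
    by (simp add: decay_def exponent_def)
  have "\<exists>U. (\<forall>x\<in>cball 0 1. u x = U (norm x)) \<and>
     (\<forall>r\<in>{0<..1}. \<exists>D. (U has_real_derivative D) (at r within {0..1}) \<and> \<bar>D\<bar> \<le> decay r)"
    if l: "l \<in> {0<..lambda_star (grad \<gamma>) f}"
      and u: "if l < lambda_star (grad \<gamma>) f then minimal_solution (grad \<gamma>) f l u
        else extremal_solution (grad \<gamma>) f u" for l u
  proof (cases "l < lambda_star (grad \<gamma>) f")
    case True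
    then have l': "0 < l" and min: "minimal_solution (grad \<gamma>) f l u" using l u by auto
    obtain W m where W: "radial_solution l W m" "\<And>x. x \<in> cball 0 1 \<Longrightarrow> u x = W (norm x)"
      "\<And>r. r \<in> {0<..1} \<Longrightarrow> \<bar>- (r * m r)\<bar> \<le> decay r"
      using minimal_solution_profile[OF l' True min] by blast
    have "(W has_real_derivative - (r * m r)) (at r within {0..1})" if "r \<in> {0<..1}" for r
      using profileD(4)[OF radial_solutionD(1)[OF W(1)], of r] that by auto
    then show ?thesis using W(2,3) by blast
  next
    case False
    then show ?thesis using l u by (intro extremal_solution_gradient_bound) auto
  qed
  then show ?thesis
    unfolding decay_eq using gradient_const_pos by blast
qed

end
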